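(* Assume that $s_a>s_r$, let $s\ge s_a$ with $s>d/2$, let $R>0$ and $\lambda\ge0$, and let $\sigma(n)>0$ satisfy $\sigma(n)\sim n^{-\lambda/d}$. Put $$\lambda_M=s_a+\frac d2\Big(\frac{s_a}{s_r}-1\Big).$$ Let $e_{\mathrm{reg}}(n)=e(\beta^\star(\sigma(n),n),\sigma(n),n)$, where $\beta^\star(\sigma,n)>0$ satisfies $\beta^\star(\sigma,n)\sim\sigma^{2/(2s_r+d)}n^{-1/(2s_r+d)}$, and let $e_{\mathrm{noreg}}(n)=e(0,\sigma(n),n)$. Then: - if $\lambda\le s_a$: $e_{\mathrm{reg}}(n)\sim n^{-\frac{2\lambda+d}{2s_r+d}\frac{s_r}{d}}$ and $e_{\mathrm{noreg}}(n)\sim n^{-\frac{\lambda}{d}}$; - if $s_a<\lambda<\lambda_M$: $e_{\mathrm{reg}}(n)\sim n^{-\frac{2\lambda+d}{2s_r+d}\frac{s_r}{d}}$ and $e_{\mathrm{noreg}}(n)\sim n^{-\frac{s_a}{d}}$; - if $\lambda\ge\lambda_M$: $e_{\mathrm{reg}}(n)\lesssim n^{-\frac{s_a}{d}}$ and $e_{\mathrm{noreg}}(n)\sim n^{-\frac{s_a}{d}}$.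
   Context: Setting. $d\ge 1$ is an integer and $\Omega\subset\mathbb{R}^d$ is a smooth bounded connected open set. $\|\cdot\|$ is the $L^2(\Omega)$-norm, $\|\cdot\|_s$ the norm of the fractional Sobolev space $H^s(\Omega)$, $H^s_0(\Omega)$ the closure of $C_c^\infty(\Omega)$ in $H^s(\Omega)$, and $\mathcal{F}(s,R)=\{f\in H^s_0(\Omega):\|f\|_s\le R\}$. Always $s>d/2$, so that elements of $H^s_0(\Omega)$ are continuous on $\overline\Omega$. Convention. $u\lesssim v$ means $u\le Cv$ with a constant $C>0$ independent of $n,\sigma,\beta,i$ (it may depend on $\Omega,d,K,s,R,s_a,s_r,\lambda$ and the given families); $u\gtrsim v$ means $v\lesssim u$; $u\sim v$ means $u\lesssim v$ and $v\lesssim u$. Discretisation. For each integer $n\ge1$ we are given points $x_1,\dots,x_n\in\overline\Omega$, functions $\phi_1,\dots,\phi_n\in C^0(\overline\Omega)$ (all depending on $n$) and a number $h=h_n>0$ with $h\sim n^{-1/d}$. Put $E_nf=(f(x_i))_{1\le i\le n}$ and $P_nz=\sum_{i=1}^n z_i\phi_i$ for $z\in\mathbb{R}^n$. Assume: - $\|\phi_i\|\sim h^{d/2}$ and $\|\phi_i\|_{L^1(\Omega)}\sim h^d$, uniformly in $i$ and $n$; - for a number $s_a>0$ (the order of the approximation method): for every $R>0$ and $s\ge s_a$ (with $s>d/2$), $\sup_{f\in\mathcal{F}(s,R)}\|P_nE_nf-f\|\sim h^{s_a}$. Regularisation. $K:\mathbb{R}^d\to\mathbb{R}$ is smooth, compactly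 supported, $\int_{\mathbb{R}^d}K=1$; $K_\beta=\beta^{-d}K(\beta^{-1}\cdot)$ for $\beta>0$; and for $g\in L^2(\Omega)$, $(K_\beta*g)(x)=\int_\Omega K_\beta(x-y)g(y)\,dy$. The integer $s_r$, with $s_r-1\ge1$, is such that $\int x_1^{r_1}\cdots x_d^{r_d}K(x)\,dx=0$ for all multi-indices with $1\le|r|\le s_r-1$, while this integral is nonzero for at least one multi-index with $|r|=s_r$. Assume that for all $s\ge s_r$ and $R>0$: $\sup_{f\in\mathcal{F}(s,R)}\|K_\beta*f-f\|\lesssim\beta^{s_r}$ for all $\beta>0$, and there is $\beta_0>0$ such that $\sup_{f\in\mathcal{F}(s,R)}\|K_\beta*f-f\|\gtrsim\beta^{s_r}$ for all $0<\beta\le\beta_0$. Data and errors. $(y_\sigma)_i=f(x_i)+\sigma\xi_i$, $i=1,\dots,n$, where the $\xi_i$ are independent real random variables with mean $0$ and variance $1$. For $\beta>0$, $$e(\beta,\sigma,n)=\sup_{f\in\mathcal{F}(s,R)}\mathbb{E}\big[\|K_\beta*(P_ny_\sigma)-f\|^2\big]^{1/2},\qquad e(0,\sigma,n)=\sup_{f\in\mathcal{F}(s,R)}\mathbb{E}\big[\|P_ny_\sigma-f\|^2\big]^{1/2}.$$ *)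

theory Defs
  imports "HOL-Probability.Probability"
begin

section \<open>The relations \<open>\<lesssim>\<close> and \<open>\<sim>\<close>\<close>

text \<open>
  The constant is uniform over the index set \<open>I\<close>. Extended real values are used so that an infinite
  supremum on either side is really infinite, instead of the unspecified value of \<open>Sup\<close> on an
  unbounded set of reals.
\<close>

definition lesssim_on :: "'i set \<Rightarrow> ('i \<Rightarrow> ereal) \<Rightarrow> ('i \<Rightarrow> ereal) \<Rightarrow> bool" where
  "lesssim_on I u v \<longleftrightarrow> (\<exists>C::real. C > 0 \<and> (\<forall>i\<in>I. u i \<le> ereal C * v i))"

definition sim_on :: "'i set \<Rightarrow> ('i \<Rightarrow> ereal) \<Rightarrow> ('i \<Rightarrow> ereal) \<Rightarrow> bool" where
  "sim_on I u v \<longleftrightarrow> lesssim_on I u v \<and> lesssim_on I v u"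


section \<open>Smooth functions and smooth domains\<close>

fun Ck_on :: "nat \<Rightarrow> ('a::euclidean_space \<Rightarrow> real) \<Rightarrow> 'a set \<Rightarrow> bool" where
  "Ck_on 0 f U \<longleftrightarrow> continuous_on U f"
| "Ck_on (Suc k) f U \<longleftrightarrow> (\<forall>x\<in>U. f differentiable (at x)) \<and>
     (\<forall>b\<in>Basis. Ck_on k (\<lambda>x. frechet_derivative f (at x) b) U)"

definition smooth_on :: "('a::euclidean_space \<Rightarrow> real) \<Rightarrow> 'a set \<Rightarrow> bool" where
  "smooth_on f U \<longleftrightarrow> (\<forall>k. Ck_on k f U)"

text \<open>
  Near each boundary point, the open set is the negativity set of a smooth function whose gradient
  does not vanish there; in particular the set lies locally on one side of its boundary.
\<close>

definition smooth_boundary :: "'a::euclidean_space set \<Rightarrow> bool" where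
  "smooth_boundary \<Omega> \<longleftrightarrow> (\<forall>p\<in>frontier \<Omega>. \<exists>U \<rho>. open U \<and> p \<in> U \<and> smooth_on \<rho> U \<and>
     frechet_derivative \<rho> (at p) \<noteq> (\<lambda>_. 0) \<and> \<Omega> \<inter> U = {x \<in> U. \<rho> x < 0})"

definition fun_support :: "('a::topological_space \<Rightarrow> real) \<Rightarrow> 'a set" where
  "fun_support f = closure {x. f x \<noteq> 0}"

definition test_functions :: "'a::euclidean_space set \<Rightarrow> ('a \<Rightarrow> real) set" where
  "test_functions \<Omega> = {\<psi>. smooth_on \<psi> UNIV \<and> compact (fun_support \<psi>) \<and> fun_support \<psi> \<subseteq> \<Omega>}"


section \<open>Lebesgue norms\<close>

definition L2 :: "'a::euclidean_space set \<Rightarrow> ('a \<Rightarrow> real) set" where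
  "L2 \<Omega> = {f. f \<in> borel_measurable (lebesgue_on \<Omega>) \<and> integrable (lebesgue_on \<Omega>) (\<lambda>x. (f x)\<^sup>2)}"

definition l2norm :: "'a::euclidean_space set \<Rightarrow> ('a \<Rightarrow> real) \<Rightarrow> real" where
  "l2norm \<Omega> f = sqrt (\<integral>x. (f x)\<^sup>2 \<partial>lebesgue_on \<Omega>)"

definition l1norm :: "'a::euclidean_space set \<Rightarrow> ('a \<Rightarrow> real) \<Rightarrow> real" where
  "l1norm \<Omega> f = (\<integral>x. \<bar>f x\<bar> \<partial>lebesgue_on \<Omega>)"


section \<open>Fractional Sobolev spaces\<close>

text \<open>A multi-index is a function \<open>'n \<Rightarrow> nat\<close> on the finite type of coordinates.\<close>

definition mi_size :: "('n::finite \<Rightarrow> nat) \<Rightarrow> nat" where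
  "mi_size \<alpha> = (\<Sum>i\<in>UNIV. \<alpha> i)"

lemma finite_mi_size_le: "finite {\<alpha> :: 'n::finite \<Rightarrow> nat. mi_size \<alpha> \<le> m}"
proof (rule finite_subset)
  show "{\<alpha> :: 'n \<Rightarrow> nat. mi_size \<alpha> \<le> m} \<subseteq> (UNIV :: 'n set) \<rightarrow>\<^sub>E {..m}"
  proof
    fix \<alpha> :: "'n \<Rightarrow> nat" assume "\<alpha> \<in> {\<alpha>. mi_size \<alpha> \<le> m}"
    then have "\<alpha> i \<le> m" for i
      using member_le_sum[of i UNIV \<alpha>] by (simp add: mi_size_def)
    then show "\<alpha> \<in> UNIV \<rightarrow>\<^sub>E {..m}" by auto
  qed
  show "finite ((UNIV :: 'n set) \<rightarrow>\<^sub>E {..m})" by (rule finite_PiE) auto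
qed

definition monomial_mi :: "('n::finite \<Rightarrow> nat) \<Rightarrow> real ^ 'n \<Rightarrow> real" where
  "monomial_mi r x = (\<Prod>i\<in>UNIV. (x $ i) ^ r i)"

definition partial_deriv :: "'n::finite \<Rightarrow> (real ^ 'n \<Rightarrow> real) \<Rightarrow> real ^ 'n \<Rightarrow> real" where
  "partial_deriv i f = (\<lambda>x. frechet_derivative f (at x) (axis i 1))"

text \<open>
  The mixed derivative of order \<open>\<alpha>\<close> of a test function is computed along any list of coordinates in
  which each \<open>i\<close> occurs \<open>\<alpha> i\<close> times. Since test functions are smooth, all these lists give the same
  derivative.
\<close>

definition has_weak_deriv ::
    "(real ^ 'n::finite) set \<Rightarrow> ('n \<Rightarrow> nat) \<Rightarrow> (real ^ 'n \<Rightarrow> real) \<Rightarrow> (real ^ 'n \<Rightarrow> real) \<Rightarrow> bool" where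
  "has_weak_deriv \<Omega> \<alpha> f g \<longleftrightarrow>
     (\<forall>\<psi>\<in>test_functions \<Omega>. \<forall>l. (\<forall>i. count_list l i = \<alpha> i) \<longrightarrow>
        (\<integral>x. f x * foldr partial_deriv l \<psi> x \<partial>lebesgue_on \<Omega>) =
        (-1) ^ mi_size \<alpha> * (\<integral>x. g x * \<psi> x \<partial>lebesgue_on \<Omega>))"

text \<open>Weak derivatives are unique almost everywhere, so the choice does not affect any norm below.\<close>

definition weak_deriv ::
    "(real ^ 'n::finite) set \<Rightarrow> ('n \<Rightarrow> nat) \<Rightarrow> (real ^ 'n \<Rightarrow> real) \<Rightarrow> real ^ 'n \<Rightarrow> real" where
  "weak_deriv \<Omega> \<alpha> f = (SOME g. g \<in> L2 \<Omega> \<and> has_weak_deriv \<Omega> \<alpha> f g)"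

text \<open>
  The Sobolev--Slobodeckij definition for \<open>s = m + \<theta>\<close> with \<open>m = \<lfloor>s\<rfloor>\<close> and \<open>0 \<le> \<theta> < 1\<close>: the weak
  derivatives of order at most \<open>m\<close> are square integrable and, if \<open>\<theta> > 0\<close>, those of order \<open>m\<close> have
  finite Gagliardo seminorm of order \<open>\<theta>\<close>. Intended for \<open>s \<ge> 0\<close>.
\<close>

definition gagliardo_kernel ::
    "real \<Rightarrow> (real ^ 'n::finite \<Rightarrow> real) \<Rightarrow> (real ^ 'n) \<times> (real ^ 'n) \<Rightarrow> real" where
  "gagliardo_kernel \<theta> g =
     (\<lambda>(x, y). (g x - g y)\<^sup>2 / norm (x - y) powr (real CARD('n) + 2 * \<theta>))"

definition sobolev :: "(real ^ 'n::finite) set \<Rightarrow> real \<Rightarrow> (real ^ 'n \<Rightarrow> real) set" where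
  "sobolev \<Omega> s = {f. f \<in> L2 \<Omega> \<and>
     (\<forall>\<alpha>. mi_size \<alpha> \<le> nat \<lfloor>s\<rfloor> \<longrightarrow> (\<exists>g\<in>L2 \<Omega>. has_weak_deriv \<Omega> \<alpha> f g)) \<and>
     (frac s > 0 \<longrightarrow> (\<forall>\<alpha>. mi_size \<alpha> = nat \<lfloor>s\<rfloor> \<longrightarrow>
        integrable (lebesgue_on (\<Omega> \<times> \<Omega>)) (gagliardo_kernel (frac s) (weak_deriv \<Omega> \<alpha> f))))}"

definition sobolev_norm :: "(real ^ 'n::finite) set \<Rightarrow> real \<Rightarrow> (real ^ 'n \<Rightarrow> real) \<Rightarrow> real" where
  "sobolev_norm \<Omega> s f = sqrt (
     (\<Sum>\<alpha> | mi_size \<alpha> \<le> nat \<lfloor>s\<rfloor>. (l2norm \<Omega> (weak_deriv \<Omega> \<alpha> f))\<^sup>2) +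
     (if frac s > 0 then
        (\<Sum>\<alpha> | mi_size \<alpha> = nat \<lfloor>s\<rfloor>.
           \<integral>p. gagliardo_kernel (frac s) (weak_deriv \<Omega> \<alpha> f) p \<partial>lebesgue_on (\<Omega> \<times> \<Omega>))
      else 0))"

definition sobolev0 :: "(real ^ 'n::finite) set \<Rightarrow> real \<Rightarrow> (real ^ 'n \<Rightarrow> real) set" where
  "sobolev0 \<Omega> s = {f \<in> sobolev \<Omega> s.
     \<forall>\<epsilon>>0. \<exists>\<psi>\<in>test_functions \<Omega>. sobolev_norm \<Omega> s (\<lambda>x. f x - \<psi> x) < \<epsilon>}"

text \<open>
  The ball \<open>\<F>(s, R)\<close>. For \<open>s > d/2\<close> every class in \<open>H\<^sup>s\<^sub>0(\<Omega>)\<close> has exactly one representative that is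
  continuous on the closure of \<open>\<Omega>\<close>; point values always refer to it, so only these representatives
  are kept. Values outside the closure are never used.
\<close>

definition sobolev_ball :: "(real ^ 'n::finite) set \<Rightarrow> real \<Rightarrow> real \<Rightarrow> (real ^ 'n \<Rightarrow> real) set" where
  "sobolev_ball \<Omega> s R =
     {f \<in> sobolev0 \<Omega> s. continuous_on (closure \<Omega>) f \<and> sobolev_norm \<Omega> s f \<le> R}"


section \<open>Discretisation, regularisation and errors\<close>

text \<open>For each \<open>n\<close>, the nodes \<open>x n i\<close> and the basis functions \<open>\<phi> n i\<close> are relevant for \<open>1 \<le> i \<le> n\<close>.\<close>

definition eval_op :: "(nat \<Rightarrow> nat \<Rightarrow> 'a) \<Rightarrow> nat \<Rightarrow> ('a \<Rightarrow> real) \<Rightarrow> nat \<Rightarrow> real" where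
  "eval_op x n f = (\<lambda>i. f (x n i))"

definition recon_op :: "(nat \<Rightarrow> nat \<Rightarrow> 'a \<Rightarrow> real) \<Rightarrow> nat \<Rightarrow> (nat \<Rightarrow> real) \<Rightarrow> 'a \<Rightarrow> real" where
  "recon_op \<phi> n z = (\<lambda>t. \<Sum>i=1..n. z i * \<phi> n i t)"

definition scaled_kernel :: "(real ^ 'n::finite \<Rightarrow> real) \<Rightarrow> real \<Rightarrow> real ^ 'n \<Rightarrow> real" where
  "scaled_kernel K \<beta> = (\<lambda>x. K (x /\<^sub>R \<beta>) / \<beta> ^ CARD('n))"

definition conv_on ::
    "'a::euclidean_space set \<Rightarrow> ('a \<Rightarrow> real) \<Rightarrow> ('a \<Rightarrow> real) \<Rightarrow> 'a \<Rightarrow> real" where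
  "conv_on \<Omega> k g = (\<lambda>x. \<integral>y. k (x - y) * g y \<partial>lebesgue_on \<Omega>)"

definition approx_err ::
    "(real ^ 'n::finite) set \<Rightarrow> (nat \<Rightarrow> nat \<Rightarrow> real ^ 'n) \<Rightarrow> (nat \<Rightarrow> nat \<Rightarrow> real ^ 'n \<Rightarrow> real) \<Rightarrow>
     real \<Rightarrow> real \<Rightarrow> nat \<Rightarrow> ereal" where
  "approx_err \<Omega> x \<phi> s R n =
     (SUP f\<in>sobolev_ball \<Omega> s R. ereal (l2norm \<Omega> (\<lambda>t. recon_op \<phi> n (eval_op x n f) t - f t)))"

definition smoothing_err ::
    "(real ^ 'n::finite) set \<Rightarrow> (real ^ 'n \<Rightarrow> real) \<Rightarrow> real \<Rightarrow> real \<Rightarrow> real \<Rightarrow> ereal" where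
  "smoothing_err \<Omega> K s R \<beta> =
     (SUP f\<in>sobolev_ball \<Omega> s R. ereal (l2norm \<Omega> (\<lambda>t. conv_on \<Omega> (scaled_kernel K \<beta>) f t - f t)))"

definition noisy_data ::
    "(nat \<Rightarrow> nat \<Rightarrow> 'a) \<Rightarrow> (nat \<Rightarrow> nat \<Rightarrow> 'w \<Rightarrow> real) \<Rightarrow> nat \<Rightarrow> real \<Rightarrow> ('a \<Rightarrow> real) \<Rightarrow> 'w \<Rightarrow> nat \<Rightarrow> real" where
  "noisy_data x \<xi> n \<sigma> f \<omega> = (\<lambda>i. eval_op x n f i + \<sigma> * \<xi> n i \<omega>)"

definition err_reg ::
    "(real ^ 'n::finite) set \<Rightarrow> (nat \<Rightarrow> nat \<Rightarrow> real ^ 'n) \<Rightarrow> (nat \<Rightarrow> nat \<Rightarrow> real ^ 'n \<Rightarrow> real) \<Rightarrow>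
     (real ^ 'n \<Rightarrow> real) \<Rightarrow> 'w measure \<Rightarrow> (nat \<Rightarrow> nat \<Rightarrow> 'w \<Rightarrow> real) \<Rightarrow> real \<Rightarrow> real \<Rightarrow>
     real \<Rightarrow> real \<Rightarrow> nat \<Rightarrow> ereal" where
  "err_reg \<Omega> x \<phi> K M \<xi> s R \<beta> \<sigma> n =
     (SUP f\<in>sobolev_ball \<Omega> s R. ereal (sqrt (\<integral>\<omega>.
        (l2norm \<Omega> (\<lambda>t. conv_on \<Omega> (scaled_kernel K \<beta>)
            (recon_op \<phi> n (noisy_data x \<xi> n \<sigma> f \<omega>)) t - f t))\<^sup>2 \<partial>M)))"

definition err_noreg ::
    "(real ^ 'n::finite) set \<Rightarrow> (nat \<Rightarrow> nat \<Rightarrow> real ^ 'n) \<Rightarrow> (nat \<Rightarrow> nat \<Rightarrow> real ^ 'n \<Rightarrow> real) \<Rightarrow>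
     'w measure \<Rightarrow> (nat \<Rightarrow> nat \<Rightarrow> 'w \<Rightarrow> real) \<Rightarrow> real \<Rightarrow> real \<Rightarrow> real \<Rightarrow> nat \<Rightarrow> ereal" where
  "err_noreg \<Omega> x \<phi> M \<xi> s R \<sigma> n =
     (SUP f\<in>sobolev_ball \<Omega> s R. ereal (sqrt (\<integral>\<omega>.
        (l2norm \<Omega> (\<lambda>t. recon_op \<phi> n (noisy_data x \<xi> n \<sigma> f \<omega>) t - f t))\<^sup>2 \<partial>M)))"

end

theory Submission
  imports Defs
begin

text \<open>
  The noise is centred and uncorrelated, so the mean square error of a linear reconstruction splits
  into a squared bias plus \<open>\<sigma>\<^sup>2 \<Sum>\<^sub>i \<parallel>\<psi>\<^sub>i\<parallel>\<^sup>2\<close>, where \<open>\<psi>\<^sub>i\<close> is \<open>\<phi>\<^sub>i\<close> or \<open>K\<^sub>\<beta> * \<phi>\<^sub>i\<close>. Without regularisation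
  this sum is of order \<open>n h\<^sup>d \<sim> 1\<close>; with it, Young's inequality \<open>\<parallel>K\<^sub>\<beta> * \<phi>\<parallel>\<^sub>2 \<le> \<parallel>K\<^sub>\<beta>\<parallel>\<^sub>2 \<parallel>\<phi>\<parallel>\<^sub>1\<close> gives
  \<open>n \<beta>\<^bsup>-d\<^esup> h\<^bsup>2d\<^esup> \<sim> \<beta>\<^bsup>-d\<^esup> / n\<close>. By \<open>\<parallel>K\<^sub>\<beta> * g\<parallel>\<^sub>2 \<le> \<parallel>K\<parallel>\<^sub>1 \<parallel>g\<parallel>\<^sub>2\<close> the regularised bias differs from the
  smoothing error, of order \<open>\<beta>\<close> to the power \<open>s_r\<close>, by at most a multiple of \<open>h\<close> to the power \<open>s_a\<close>.
  The choice of \<open>\<beta>\<close> balances variance and smoothing error, and \<open>\<lambda>\<^sub>M\<close> is the noise level at which the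
  smoothing error stops dominating the approximation error.
\<close>

section \<open>Bounded measurable functions\<close>

text \<open>On a finite measure these functions are integrable, and the class is closed under sums,
  products, squares and square roots. Integrability of every integrand on the domain thus reduces to
  membership. The bound holds at every point of the space, not merely almost everywhere, so
  pointwise operations preserve it directly.\<close>

definition bdd_meas :: "'a measure \<Rightarrow> ('a \<Rightarrow> real) set" where
  "bdd_meas N = {g \<in> borel_measurable N. \<exists>B. \<forall>x\<in>space N. \<bar>g x\<bar> \<le> B}"

lemma bdd_measI: "g \<in> borel_measurable N \<Longrightarrow> (\<And>x. x \<in> space N \<Longrightarrow> \<bar>g x\<bar> \<le> B) \<Longrightarrow> g \<in> bdd_meas N"
  by (auto simp: bdd_meas_def)

lemma bdd_meas_measurable: "g \<in> bdd_meas N \<Longrightarrow> g \<in> borel_measurable N"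
  by (simp add: bdd_meas_def)

lemma bdd_meas_bound:
  assumes "g \<in> bdd_meas N"
  obtains B where "B \<ge> 0" "\<And>x. x \<in> space N \<Longrightarrow> \<bar>g x\<bar> \<le> B"
proof -
  obtain B where "\<forall>x\<in>space N. \<bar>g x\<bar> \<le> B" using assms by (auto simp: bdd_meas_def)
  then show ?thesis by (intro that[of "max B 0"]) auto
qed

lemma bdd_meas_const: "(\<lambda>_. c) \<in> bdd_meas N"
  by (auto simp: bdd_meas_def)

lemma bdd_meas_add:
  assumes "f \<in> bdd_meas N" "g \<in> bdd_meas N"
  shows "(\<lambda>x. f x + g x) \<in> bdd_meas N"
proof -
  obtain A where "\<And>x. x \<in> space N \<Longrightarrow> \<bar>f x\<bar> \<le> A" using assms(1) by (rule bdd_meas_bound) blast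
  moreover obtain B where "\<And>x. x \<in> space N \<Longrightarrow> \<bar>g x\<bar> \<le> B" using assms(2) by (rule bdd_meas_bound) blast
  ultimately show ?thesis using assms[THEN bdd_meas_measurable]
    by (intro bdd_measI[of _ _ "A + B"]) (auto intro: order_trans[OF abs_triangle_ineq] add_mono)
qed

lemma bdd_meas_mult:
  assumes "f \<in> bdd_meas N" "g \<in> bdd_meas N"
  shows "(\<lambda>x. f x * g x) \<in> bdd_meas N"
proof -
  obtain A where A: "A \<ge> 0" "\<And>x. x \<in> space N \<Longrightarrow> \<bar>f x\<bar> \<le> A" using assms(1) by (rule bdd_meas_bound) blast
  obtain B where B: "B \<ge> 0" "\<And>x. x \<in> space N \<Longrightarrow> \<bar>g x\<bar> \<le> B" using assms(2) by (rule bdd_meas_bound) blast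
  have "\<bar>f x * g x\<bar> \<le> A * B" if "x \<in> space N" for x
    unfolding abs_mult using A B that by (intro mult_mono) auto
  then show ?thesis using assms[THEN bdd_meas_measurable]
    by (intro bdd_measI[of _ _ "A * B"]) auto
qed

lemma bdd_meas_abs: "f \<in> bdd_meas N \<Longrightarrow> (\<lambda>x. \<bar>f x\<bar>) \<in> bdd_meas N"
  by (auto simp: bdd_meas_def)

lemma bdd_meas_sqrt:
  assumes "f \<in> bdd_meas N"
  shows "(\<lambda>x. sqrt (f x)) \<in> bdd_meas N"
proof -
  obtain B where B: "\<And>x. x \<in> space N \<Longrightarrow> \<bar>f x\<bar> \<le> B" using assms by (rule bdd_meas_bound) blast
  \<comment> \<open>The total function \<open>sqrt\<close> is odd on the reals, so the absolute
    value of \<open>sqrt y\<close> is \<open>sqrt \<bar>y\<bar>\<close>; this covers negative values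
    of \<open>f\<close> as well.\<close>
  then show ?thesis using bdd_meas_measurable[OF assms]
    by (intro bdd_measI[of _ _ "sqrt B"]) (auto simp: sqrt_def real_root_abs[symmetric])
qed

lemma bdd_meas_cmult: "f \<in> bdd_meas N \<Longrightarrow> (\<lambda>x. c * f x) \<in> bdd_meas N"
  by (rule bdd_meas_mult[OF bdd_meas_const])

lemma bdd_meas_diff: "f \<in> bdd_meas N \<Longrightarrow> g \<in> bdd_meas N \<Longrightarrow> (\<lambda>x. f x - g x) \<in> bdd_meas N"
  using bdd_meas_add[of f N "\<lambda>x. (-1) * g x"] bdd_meas_cmult[of g N "-1"] by simp

lemma bdd_meas_power2: "f \<in> bdd_meas N \<Longrightarrow> (\<lambda>x. (f x)\<^sup>2) \<in> bdd_meas N"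
  unfolding power2_eq_square by (rule bdd_meas_mult)

lemma bdd_meas_sum: "(\<And>i. i \<in> I \<Longrightarrow> f i \<in> bdd_meas N) \<Longrightarrow> (\<lambda>x. \<Sum>i\<in>I. f i x) \<in> bdd_meas N"
  by (induction I rule: infinite_finite_induct) (auto intro: bdd_meas_const bdd_meas_add)

lemmas bdd_meas_intros = bdd_meas_const bdd_meas_add bdd_meas_mult bdd_meas_cmult bdd_meas_abs
  bdd_meas_diff bdd_meas_power2 bdd_meas_sum bdd_meas_sqrt

text \<open>The measure is a parameter because the seminorm is taken on the domain for
  reconstructions and on the whole space for the kernel. On the domain it agrees with
  \<open>l2norm\<close> for functions in \<open>bdd_meas\<close>, by
  \<open>l2norm_eq\<close>.\<close>

definition L2_seminorm :: "'a measure \<Rightarrow> ('a \<Rightarrow> real) \<Rightarrow> real" where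
  "L2_seminorm N g = sqrt (\<integral>x. (g x)\<^sup>2 \<partial>N)"

context finite_measure
begin

lemma integrable_bdd_meas: "g \<in> bdd_meas M \<Longrightarrow> integrable M g"
  by (auto simp: bdd_meas_def intro!: integrable_const_bound AE_I2)

text \<open>The integral of \<open>(a * f x + b * g x)\<^sup>2\<close> is a nonnegative quadratic
  form in \<open>a\<close> and \<open>b\<close>, so its discriminant has the right sign.\<close>

lemma Cauchy_Schwarz_integral:
  assumes f: "f \<in> bdd_meas M" and g: "g \<in> bdd_meas M"
  shows "(\<integral>x. f x * g x \<partial>M)\<^sup>2 \<le> (\<integral>x. (f x)\<^sup>2 \<partial>M) * (\<integral>x. (g x)\<^sup>2 \<partial>M)"
proof -
  define A C D where "A = (\<integral>x. (f x)\<^sup>2 \<partial>M)" and "C = (\<integral>x. f x * g x \<partial>M)" and "D = (\<integral>x. (g x)\<^sup>2 \<partial>M)"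
  have quad: "0 \<le> a\<^sup>2 * A + 2 * a * b * C + b\<^sup>2 * D" for a b
  proof -
    have "0 \<le> (\<integral>x. (a * f x + b * g x)\<^sup>2 \<partial>M)" by simp
    also have "\<dots> = (\<integral>x. a\<^sup>2 * (f x)\<^sup>2 + 2 * a * b * (f x * g x) + b\<^sup>2 * (g x)\<^sup>2 \<partial>M)"
      by (simp add: power2_sum power_mult_distrib algebra_simps)
    also have "\<dots> = a\<^sup>2 * A + 2 * a * b * C + b\<^sup>2 * D"
      using f g unfolding A_def C_def D_def
      by (simp add: integrable_bdd_meas bdd_meas_intros Bochner_Integration.integral_add del: bdd_meas_const)
    finally show ?thesis .
  qed
  have nn: "A \<ge> 0" "D \<ge> 0" by (auto simp: A_def D_def)
  \<comment> \<open>The form at (D, -C) and at (C, -A) yields the wanted difference times D and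
    times A. One of the two factors is positive unless A = D = 0, and then the values at (1, 1) and
    (1, -1) force C = 0.\<close>
  have 1: "0 \<le> D * (A * D - C\<^sup>2)" using quad[of D "-C"] by (simp add: algebra_simps power2_eq_square)
  have 2: "0 \<le> A * (A * D - C\<^sup>2)" using quad[of C "-A"] by (simp add: algebra_simps power2_eq_square)
  have "C\<^sup>2 \<le> A * D"
  proof (cases "A = 0 \<and> D = 0")
    case True
    then have "C = 0" using quad[of 1 1] quad[of 1 "-1"] by simp
    then show ?thesis using nn by simp
  next
    case False
    then show ?thesis using 1 2 nn by (auto simp: zero_le_mult_iff)
  qed
  then show ?thesis by (simp add: A_def C_def D_def)
qed

text \<open>Cauchy-Schwarz for \<open>sqrt (w x)\<close> and \<open>sqrt (w x) * u x\<close>. The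
  weight is the kernel in one Young inequality and the convolved function in the other.\<close>

lemma weighted_Cauchy_Schwarz_integral:
  assumes w: "w \<in> bdd_meas M" "\<And>x. w x \<ge> 0" and u: "u \<in> bdd_meas M"
  shows "(\<integral>x. w x * u x \<partial>M)\<^sup>2 \<le> (\<integral>x. w x \<partial>M) * (\<integral>x. w x * (u x)\<^sup>2 \<partial>M)"
proof -
  have "sqrt (w x) * (sqrt (w x) * u x) = w x * u x" for x
    using w(2)[of x] by (simp add: mult.assoc[symmetric])
  moreover have "(sqrt (w x))\<^sup>2 = w x" "(sqrt (w x) * u x)\<^sup>2 = w x * (u x)\<^sup>2" for x
    using w(2)[of x] by (simp_all add: power_mult_distrib)
  moreover have "(\<integral>x. sqrt (w x) * (sqrt (w x) * u x) \<partial>M)\<^sup>2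
      \<le> (\<integral>x. (sqrt (w x))\<^sup>2 \<partial>M) * (\<integral>x. (sqrt (w x) * u x)\<^sup>2 \<partial>M)"
    by (intro Cauchy_Schwarz_integral bdd_meas_mult bdd_meas_sqrt w u)
  ultimately show ?thesis by (simp only:)
qed

lemma L2_seminorm_triangle:
  assumes f: "f \<in> bdd_meas M" and g: "g \<in> bdd_meas M"
  shows "L2_seminorm M (\<lambda>x. f x + g x) \<le> L2_seminorm M f + L2_seminorm M g"
proof -
  define A C D where "A = (\<integral>x. (f x)\<^sup>2 \<partial>M)" and "C = (\<integral>x. f x * g x \<partial>M)" and "D = (\<integral>x. (g x)\<^sup>2 \<partial>M)"
  have nn: "A \<ge> 0" "D \<ge> 0" by (auto simp: A_def D_def)
  have "(\<integral>x. (f x + g x)\<^sup>2 \<partial>M) = (\<integral>x. (f x)\<^sup>2 + 2 * (f x * g x) + (g x)\<^sup>2 \<partial>M)"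
    by (simp add: power2_sum algebra_simps)
  also have "\<dots> = A + 2 * C + D"
    using f g unfolding A_def C_def D_def by (simp add: integrable_bdd_meas bdd_meas_intros)
  also have "C \<le> sqrt A * sqrt D"
    using Cauchy_Schwarz_integral[OF f g]
    unfolding A_def[symmetric] C_def[symmetric] D_def[symmetric]
    by (metis real_sqrt_mult real_le_rsqrt)
  then have "A + 2 * C + D \<le> (sqrt A + sqrt D)\<^sup>2" using nn by (simp add: power2_sum)
  finally show ?thesis
    using nn unfolding L2_seminorm_def A_def[symmetric] D_def[symmetric]
    by (simp add: real_le_lsqrt)
qed

lemma L2_seminorm_cmult: "L2_seminorm M (\<lambda>x. c * f x) = \<bar>c\<bar> * L2_seminorm M f"
  by (simp add: L2_seminorm_def power_mult_distrib real_sqrt_mult)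

lemma L2_seminorm_diff_triangle:
  assumes f: "f \<in> bdd_meas M" and g: "g \<in> bdd_meas M" and h: "h \<in> bdd_meas M"
  shows "L2_seminorm M (\<lambda>x. f x - h x) \<le> L2_seminorm M (\<lambda>x. f x - g x) + L2_seminorm M (\<lambda>x. g x - h x)"
  using L2_seminorm_triangle[of "\<lambda>x. f x - g x" "\<lambda>x. g x - h x"] assms by (simp add: bdd_meas_intros)

text \<open>Serves the strict positivity of the regularised error: if all regularised basis
  functions have norm zero, so has every regularised reconstruction.\<close>

lemma L2_seminorm_sum_zero:
  assumes f: "\<And>i. i \<in> I \<Longrightarrow> f i \<in> bdd_meas M" and z: "\<And>i. i \<in> I \<Longrightarrow> L2_seminorm M (f i) = 0"
  shows "L2_seminorm M (\<lambda>x. \<Sum>i\<in>I. c i * f i x) = 0"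
  using assms
proof (induction I rule: infinite_finite_induct)
  case (insert i I)
  have "L2_seminorm M (\<lambda>x. \<Sum>i\<in>insert i I. c i * f i x)
      = L2_seminorm M (\<lambda>x. c i * f i x + (\<Sum>i\<in>I. c i * f i x))" using insert by simp
  also have "\<dots> \<le> L2_seminorm M (\<lambda>x. c i * f i x) + L2_seminorm M (\<lambda>x. \<Sum>i\<in>I. c i * f i x)"
    using insert.prems by (intro L2_seminorm_triangle bdd_meas_intros) auto
  also have "\<dots> = 0" using insert by (simp add: L2_seminorm_cmult)
  finally show ?case by (simp add: L2_seminorm_def antisym)
qed (auto simp: L2_seminorm_def)

end

section \<open>Convolution on a bounded open set\<close>

text \<open>Used with \<open>c = 1\<close> for translations, \<open>c = -1\<close> for reflections
  and \<open>c = inverse \<beta>\<close> for rescaling. For a non-integrable \<open>f\<close> both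
  sides take the default value 0.\<close>

lemma lborel_integral_affine:
  fixes f :: "'a::euclidean_space \<Rightarrow> real"
  assumes [measurable]: "f \<in> borel_measurable borel" and c: "c \<noteq> 0"
  shows "(\<integral>x. f x \<partial>lborel) = \<bar>c\<bar> ^ DIM('a) * (\<integral>x. f (t + c *\<^sub>R x) \<partial>lborel)"
  by (subst lborel_affine[OF c, of t]) (simp add: integral_density integral_distr)

lemma lborel_integrable_affine:
  fixes f :: "'a::euclidean_space \<Rightarrow> real"
  assumes [measurable]: "f \<in> borel_measurable borel" and c: "c \<noteq> 0"
  shows "integrable lborel (\<lambda>x. f (t + c *\<^sub>R x)) \<longleftrightarrow> integrable lborel f"
proof -
  have "integrable lborel f \<longleftrightarrow>
      integrable (density (distr lborel borel (\<lambda>x. t + c *\<^sub>R x)) (\<lambda>_. \<bar>c\<bar> ^ DIM('a))) f"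
    by (subst lborel_affine[OF c, of t]) simp
  also have "\<dots> \<longleftrightarrow> integrable lborel (\<lambda>x. f (t + c *\<^sub>R x))"
    using c by (simp add: integrable_density integrable_distr_eq)
  finally show ?thesis by simp
qed

locale bounded_open_set =
  fixes \<Omega> :: "'a::euclidean_space set"
  assumes open_domain: "open \<Omega>" and bounded_domain: "bounded \<Omega>"
begin

text \<open>Restricting \<open>lborel\<close> instead of \<open>lebesgue\<close> makes \<open>(x, y) \<mapsto> k (x - y)\<close> measurable for
  the product measure, as Fubini requires.\<close>
abbreviation N :: "'a measure" where "N \<equiv> restrict_space lborel \<Omega>"

lemma sets_domain [measurable, simp]: "\<Omega> \<in> sets borel"
  using open_domain by auto

lemma space_N [simp]: "space N = \<Omega>"
  by (simp add: space_restrict_space)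

sublocale finite_measure N
proof
  show "emeasure N (space N) \<noteq> \<infinity>"
    using emeasure_bounded_finite[OF bounded_domain]
    by (simp add: emeasure_restrict_space less_top)
qed

lemma measurable_N_eq: "borel_measurable N = borel_measurable (restrict_space borel \<Omega>)"
  by (rule measurable_cong_sets) (simp_all add: sets_restrict_space)

lemma measurable_N: "f \<in> measurable borel L \<Longrightarrow> f \<in> measurable N L"
  by (intro measurable_restrict_space1) simp

text \<open>The closure of the bounded domain is compact. This is how the elements of the Sobolev
  ball and the basis functions enter \<open>bdd_meas\<close>.\<close>

lemma bdd_meas_continuous_on_closure:
  assumes "continuous_on (closure \<Omega>) f"
  shows "f \<in> bdd_meas N"
proof -
  have "compact (f ` closure \<Omega>)"
    using assms bounded_domain by (intro compact_continuous_image) (auto simp: compact_eq_bounded_closed)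
  then obtain B where "\<forall>y\<in>f ` closure \<Omega>. norm y \<le> B"
    using compact_imp_bounded bounded_iff by metis
  moreover have "continuous_on \<Omega> f" using assms closure_subset continuous_on_subset by blast
  ultimately show ?thesis
    using closure_subset
    by (intro bdd_measI[where B=B]) (auto simp: measurable_N_eq intro: borel_measurable_continuous_on_restrict)
qed

text \<open>Both sides are integrals over the whole space of the extension by zero, and completing
  the measure does not change the integral of a Borel function.\<close>

lemma integral_lebesgue_on_eq:
  fixes g :: "'a \<Rightarrow> real"
  assumes "g \<in> borel_measurable N"
  shows "(\<integral>x. g x \<partial>lebesgue_on \<Omega>) = (\<integral>x. g x \<partial>N)"
proof -
  have m: "(\<lambda>x. indicator \<Omega> x *\<^sub>R g x) \<in> borel_measurable lborel"
    using assms by (subst (asm) borel_measurable_restrict_space_iff) simp_all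
  have "(\<integral>x. g x \<partial>lebesgue_on \<Omega>) = (\<integral>x. indicator \<Omega> x *\<^sub>R g x \<partial>lebesgue)"
    by (subst integral_restrict_space) auto
  also have "\<dots> = (\<integral>x. indicator \<Omega> x *\<^sub>R g x \<partial>lborel)" by (rule integral_completion[OF m])
  also have "\<dots> = (\<integral>x. g x \<partial>N)" by (subst integral_restrict_space) auto
  finally show ?thesis .
qed

lemma l2norm_eq: "g \<in> bdd_meas N \<Longrightarrow> l2norm \<Omega> g = L2_seminorm N g"
  unfolding l2norm_def L2_seminorm_def
  by (subst integral_lebesgue_on_eq) (auto intro!: bdd_meas_measurable bdd_meas_intros)

lemma l1norm_eq: "g \<in> bdd_meas N \<Longrightarrow> l1norm \<Omega> g = (\<integral>x. \<bar>g x\<bar> \<partial>N)"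
  unfolding l1norm_def
  by (subst integral_lebesgue_on_eq) (auto intro!: bdd_meas_measurable bdd_meas_intros)

lemma pair_measurable:
  assumes [measurable]: "q \<in> borel_measurable borel" "g \<in> borel_measurable N"
  shows "(\<lambda>(x, y). (q (x - y) :: real) * g y) \<in> borel_measurable (N \<Otimes>\<^sub>M N)"
proof -
  have [measurable]: "(\<lambda>x. x) \<in> measurable N borel" by (rule measurable_N) simp
  have [measurable]: "fst \<in> measurable (N \<Otimes>\<^sub>M N) borel" "snd \<in> measurable (N \<Otimes>\<^sub>M N) borel"
    using measurable_compose[OF measurable_fst, of "\<lambda>x. x" N borel N]
      measurable_compose[OF measurable_snd, of "\<lambda>x. x" N borel N] by simp_all
  show ?thesis unfolding case_prod_beta by measurable
qed

lemma abs_integral_mult_le: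
  assumes "f \<in> bdd_meas N" "g \<in> bdd_meas N"
  shows "(\<integral>y. f y * g y \<partial>N)\<^sup>2 \<le> (\<integral>y. \<bar>f y\<bar> * \<bar>g y\<bar> \<partial>N)\<^sup>2"
proof -
  have "\<bar>\<integral>y. f y * g y \<partial>N\<bar> \<le> (\<integral>y. \<bar>f y * g y\<bar> \<partial>N)"
    using integral_norm_bound[of N "\<lambda>y. f y * g y"] by simp
  then show ?thesis by (subst abs_le_square_iff[symmetric]) (simp add: abs_mult)
qed

text \<open>Nonnegativity lets the domain be enlarged to the whole space, where Lebesgue measure is
  invariant under translation and reflection.\<close>

lemma integral_translates_le:
  fixes q :: "'a \<Rightarrow> real"
  assumes q: "q \<in> borel_measurable borel" "integrable lborel q" "\<And>x. q x \<ge> 0"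
  shows "(\<integral>x. q (x - y) \<partial>N) \<le> (\<integral>x. q x \<partial>lborel)" "(\<integral>y. q (x - y) \<partial>N) \<le> (\<integral>x. q x \<partial>lborel)"
proof -
  have le: "(\<integral>x. p x \<partial>N) \<le> (\<integral>x. p x \<partial>lborel)"
    if "integrable lborel p" "\<And>x. p x \<ge> 0" for p :: "'a \<Rightarrow> real"
  proof -
    have "(\<integral>x. p x \<partial>N) = (\<integral>x. indicator \<Omega> x *\<^sub>R p x \<partial>lborel)"
      by (subst integral_restrict_space) auto
    also have "\<dots> \<le> (\<integral>x. p x \<partial>lborel)"
      using that by (intro integral_mono integrable_mult_indicator) (auto simp: indicator_def)
    finally show ?thesis .
  qed
  show "(\<integral>x. q (x - y) \<partial>N) \<le> (\<integral>x. q x \<partial>lborel)"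
    using le[of "\<lambda>x. q (x - y)"] q lborel_integral_affine[of q 1 "-y"] lborel_integrable_affine[of q 1 "-y"]
    by simp
  show "(\<integral>y. q (x - y) \<partial>N) \<le> (\<integral>x. q x \<partial>lborel)"
    using le[of "\<lambda>y. q (x - y)"] q lborel_integral_affine[of q "-1" x] lborel_integrable_affine[of q "-1" x]
    by simp
qed

text \<open>The integrand is bounded on a finite product measure, so Fubini applies; after the
  exchange the inner integral is that of a translate of \<open>q\<close>. The two uses are
  \<open>\<bar>k\<bar>\<close> against the square of \<open>g\<close>, and the square of
  \<open>k\<close> against \<open>\<bar>g\<bar>\<close>.\<close>

lemma integral_conv_le:
  fixes q :: "'a \<Rightarrow> real"
  assumes q: "q \<in> borel_measurable borel" "bounded (range q)" "integrable lborel q" "\<And>x. q x \<ge> 0"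
    and g: "g \<in> bdd_meas N" "\<And>x. g x \<ge> 0"
  shows "(\<integral>x. (\<integral>y. q (x - y) * g y \<partial>N) \<partial>N) \<le> (\<integral>x. q x \<partial>lborel) * (\<integral>y. g y \<partial>N)"
    and "integrable N (\<lambda>x. \<integral>y. q (x - y) * g y \<partial>N)"
proof -
  interpret P: pair_sigma_finite N N ..
  interpret NN: finite_measure "N \<Otimes>\<^sub>M N"
    by (intro finite_measure_pair_measure finite_measure_axioms)
  obtain A where A: "A \<ge> 0" "\<And>x. \<bar>q x\<bar> \<le> A"
    using q(2) by (auto simp: bounded_pos intro: that less_imp_le)
  obtain B where B: "B \<ge> 0" "\<And>x. x \<in> \<Omega> \<Longrightarrow> \<bar>g x\<bar> \<le> B" using g(1) by (rule bdd_meas_bound) auto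
  have "(\<lambda>(x, y). q (x - y) * g y) \<in> bdd_meas (N \<Otimes>\<^sub>M N)"
    using pair_measurable[OF q(1) bdd_meas_measurable[OF g(1)]] A B
    by (intro bdd_measI[where B="A * B"]) (auto simp: space_pair_measure abs_mult intro!: mult_mono)
  then have int: "integrable (N \<Otimes>\<^sub>M N) (\<lambda>(x, y). q (x - y) * g y)"
    by (rule NN.integrable_bdd_meas)
  have "(\<integral>x. (\<integral>y. q (x - y) * g y \<partial>N) \<partial>N) = (\<integral>y. (\<integral>x. q (x - y) * g y \<partial>N) \<partial>N)"
    using P.Fubini_integral[OF int] by simp
  also have "\<dots> = (\<integral>y. (\<integral>x. q (x - y) \<partial>N) * g y \<partial>N)" by simp
  also have "\<dots> \<le> (\<integral>y. (\<integral>x. q x \<partial>lborel) * g y \<partial>N)"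
  proof (rule integral_mono)
    show "integrable N (\<lambda>y. (\<integral>x. q (x - y) \<partial>N) * g y)"
      using P.integrable_snd[OF int] by simp
    show "integrable N (\<lambda>y. (\<integral>x. q x \<partial>lborel) * g y)"
      using g(1) by (intro integrable_bdd_meas bdd_meas_cmult)
  qed (intro mult_right_mono integral_translates_le q g)
  finally show "(\<integral>x. (\<integral>y. q (x - y) * g y \<partial>N) \<partial>N) \<le> (\<integral>x. q x \<partial>lborel) * (\<integral>y. g y \<partial>N)"
    by simp
  show "integrable N (\<lambda>x. \<integral>y. q (x - y) * g y \<partial>N)"
    using P.integrable_fst[OF int] by simp
qed

end

text \<open>To be instantiated at \<open>scaled_kernel K \<beta>\<close> for each positive \<beta>.
  Boundedness gives integrable integrands on the domain; integrability on the whole space gives the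
  L1 and L2 norms in the Young inequalities.\<close>

locale bounded_kernel = bounded_open_set +
  fixes k :: "'a \<Rightarrow> real"
  assumes k_measurable [measurable]: "k \<in> borel_measurable borel"
    and k_bounded: "bounded (range k)"
    and k_integrable: "integrable lborel k"
begin

lemma kernel_bound: obtains B where "B \<ge> 0" "\<And>x. \<bar>k x\<bar> \<le> B"
  using k_bounded by (auto simp: bounded_pos intro: that less_imp_le)

lemma kernel_bdd_meas: "(\<lambda>y. k (t - y)) \<in> bdd_meas N" "(\<lambda>x. k (x - t)) \<in> bdd_meas N"
proof -
  obtain B where "\<And>x. \<bar>k x\<bar> \<le> B" by (rule kernel_bound) blast
  then show "(\<lambda>y. k (t - y)) \<in> bdd_meas N" "(\<lambda>x. k (x - t)) \<in> bdd_meas N"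
    by (auto intro!: bdd_measI[where B=B] measurable_N)
qed

lemma conv_on_eq:
  assumes "g \<in> bdd_meas N"
  shows "conv_on \<Omega> k g x = (\<integral>y. k (x - y) * g y \<partial>N)"
  unfolding conv_on_def using assms kernel_bdd_meas
  by (intro integral_lebesgue_on_eq bdd_meas_measurable bdd_meas_mult)

text \<open>The bound is the product of the two suprema and the measure of the domain; measurability
  is that of a parameter integral of a jointly measurable function.\<close>

lemma conv_bdd_meas:
  assumes g: "g \<in> bdd_meas N"
  shows "conv_on \<Omega> k g \<in> bdd_meas N"
proof -
  obtain A where A: "A \<ge> 0" "\<And>x. \<bar>k x\<bar> \<le> A" by (rule kernel_bound) blast
  obtain B where B: "B \<ge> 0" "\<And>x. x \<in> \<Omega> \<Longrightarrow> \<bar>g x\<bar> \<le> B" using g by (rule bdd_meas_bound) auto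
  have "\<bar>\<integral>y. k (x - y) * g y \<partial>N\<bar> \<le> A * B * measure N \<Omega>" for x
  proof -
    have "\<bar>k (x - y) * g y\<bar> \<le> A * B" if "y \<in> \<Omega>" for y
      unfolding abs_mult using A B that by (intro mult_mono) auto
    moreover have "integrable N (\<lambda>y. k (x - y) * g y)"
      using g kernel_bdd_meas by (intro integrable_bdd_meas bdd_meas_mult)
    moreover have "\<bar>\<integral>y. k (x - y) * g y \<partial>N\<bar> \<le> (\<integral>y. \<bar>k (x - y) * g y\<bar> \<partial>N)"
      using integral_norm_bound[of N "\<lambda>y. k (x - y) * g y"] by simp
    ultimately have "\<bar>\<integral>y. k (x - y) * g y \<partial>N\<bar> \<le> (\<integral>y. A * B \<partial>N)"
      by (elim order_trans, intro integral_mono) auto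
    then show ?thesis by (simp add: mult_ac)
  qed
  moreover have "(\<lambda>x. \<integral>y. k (x - y) * g y \<partial>N) \<in> borel_measurable N"
    using pair_measurable[OF k_measurable bdd_meas_measurable[OF g]]
    by (rule borel_measurable_lebesgue_integral)
  moreover have "conv_on \<Omega> k g = (\<lambda>x. \<integral>y. k (x - y) * g y \<partial>N)"
    using conv_on_eq[OF g] by (rule ext)
  ultimately show ?thesis by (simp only:) (rule bdd_measI)
qed

lemma conv_on_diff:
  assumes "f \<in> bdd_meas N" "g \<in> bdd_meas N"
  shows "conv_on \<Omega> k (\<lambda>x. f x - g x) x = conv_on \<Omega> k f x - conv_on \<Omega> k g x"
  using assms kernel_bdd_meas[of x]
  by (simp add: conv_on_eq bdd_meas_diff right_diff_distrib integrable_bdd_meas bdd_meas_mult)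

lemma conv_on_sum:
  assumes "\<And>i. i \<in> I \<Longrightarrow> f i \<in> bdd_meas N"
  shows "conv_on \<Omega> k (\<lambda>x. \<Sum>i\<in>I. c i * f i x) x = (\<Sum>i\<in>I. c i * conv_on \<Omega> k (f i) x)"
proof -
  have "(\<integral>y. k (x - y) * (\<Sum>i\<in>I. c i * f i y) \<partial>N) = (\<integral>y. (\<Sum>i\<in>I. c i * (k (x - y) * f i y)) \<partial>N)"
    by (simp add: sum_distrib_left mult.left_commute)
  also have "\<dots> = (\<Sum>i\<in>I. c i * (\<integral>y. k (x - y) * f i y \<partial>N))"
    using assms kernel_bdd_meas[of x]
    by (subst Bochner_Integration.integral_sum) (auto simp: integrable_bdd_meas bdd_meas_intros)
  finally show ?thesis using assms by (simp add: conv_on_eq bdd_meas_sum bdd_meas_cmult)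
qed

text \<open>Young's inequality with the L1 norm on the kernel. Cauchy-Schwarz with weight
  \<open>\<bar>k (x - y)\<bar>\<close> bounds the squared convolution pointwise by L times the
  convolution of \<open>\<bar>k\<bar>\<close> with the square of \<open>g\<close>, and integration
  in x gives a second factor L.\<close>

lemma conv_L2_le:
  assumes g: "g \<in> bdd_meas N"
  shows "L2_seminorm N (conv_on \<Omega> k g) \<le> (\<integral>x. \<bar>k x\<bar> \<partial>lborel) * L2_seminorm N g"
proof -
  define L where "L = (\<integral>x. \<bar>k x\<bar> \<partial>lborel)"
  have L: "L \<ge> 0" by (simp add: L_def)
  have kb: "(\<lambda>x. \<bar>k x\<bar>) \<in> borel_measurable borel" "bounded (range (\<lambda>x. \<bar>k x\<bar>))" "integrable lborel (\<lambda>x. \<bar>k x\<bar>)"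
    using k_bounded k_integrable by (auto simp: bounded_iff)
  have gb: "(\<lambda>x. (g x)\<^sup>2) \<in> bdd_meas N" using g by (rule bdd_meas_power2)
  note F = integral_conv_le[OF kb _ gb, simplified]
  have "(\<integral>y. \<bar>k (x - y)\<bar> \<partial>N) \<le> L" for x
    unfolding L_def using kb by (intro integral_translates_le) auto
  moreover have "(conv_on \<Omega> k g x)\<^sup>2 \<le> (\<integral>y. \<bar>k (x - y)\<bar> \<partial>N) * (\<integral>y. \<bar>k (x - y)\<bar> * (g y)\<^sup>2 \<partial>N)" for x
  proof -
    have "(conv_on \<Omega> k g x)\<^sup>2 \<le> (\<integral>y. \<bar>k (x - y)\<bar> * \<bar>g y\<bar> \<partial>N)\<^sup>2"
      unfolding conv_on_eq[OF g] using g kernel_bdd_meas by (intro abs_integral_mult_le)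
    also have "\<dots> \<le> (\<integral>y. \<bar>k (x - y)\<bar> \<partial>N) * (\<integral>y. \<bar>k (x - y)\<bar> * \<bar>g y\<bar>\<^sup>2 \<partial>N)"
      using g kernel_bdd_meas by (intro weighted_Cauchy_Schwarz_integral bdd_meas_abs) auto
    finally show ?thesis by simp
  qed
  moreover have "(\<integral>y. \<bar>k (x - y)\<bar> * (g y)\<^sup>2 \<partial>N) \<ge> 0" for x by simp
  ultimately have pt: "(conv_on \<Omega> k g x)\<^sup>2 \<le> L * (\<integral>y. \<bar>k (x - y)\<bar> * (g y)\<^sup>2 \<partial>N)" for x
    using mult_right_mono order_trans by blast
  have "(\<integral>x. (conv_on \<Omega> k g x)\<^sup>2 \<partial>N) \<le> (\<integral>x. L * (\<integral>y. \<bar>k (x - y)\<bar> * (g y)\<^sup>2 \<partial>N) \<partial>N)"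
    using g F(2) pt by (intro integral_mono integrable_bdd_meas[OF bdd_meas_power2[OF conv_bdd_meas]]) auto
  also have "\<dots> \<le> L * (L * (\<integral>x. (g x)\<^sup>2 \<partial>N))"
    using F(1) L by (simp add: L_def mult_left_mono)
  finally have "L2_seminorm N (conv_on \<Omega> k g) \<le> sqrt (L\<^sup>2 * (\<integral>x. (g x)\<^sup>2 \<partial>N))"
    unfolding L2_seminorm_def by (simp add: power2_eq_square)
  also have "\<dots> = L * L2_seminorm N g" using L by (simp add: real_sqrt_mult L2_seminorm_def)
  finally show ?thesis by (simp add: L_def)
qed

text \<open>Young's inequality with the L1 norm on the function. Here \<open>\<bar>g y\<bar>\<close>
  is the weight, so the square falls on the kernel. This is the source of the variance reduction,
  since the basis functions have small L1 norm.\<close>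

lemma conv_L2_le_L1:
  assumes g: "g \<in> bdd_meas N"
  shows "L2_seminorm N (conv_on \<Omega> k g) \<le> L2_seminorm lborel k * (\<integral>x. \<bar>g x\<bar> \<partial>N)"
proof -
  define G where "G = (\<integral>x. \<bar>g x\<bar> \<partial>N)"
  have G: "G \<ge> 0" by (simp add: G_def)
  obtain A where A: "A \<ge> 0" "\<And>x. \<bar>k x\<bar> \<le> A" by (rule kernel_bound) blast
  \<comment> \<open>A bounded integrable kernel is square integrable, because its square is
    dominated by A times its absolute value.\<close>
  have bnd: "(k x)\<^sup>2 \<le> A * \<bar>k x\<bar>" for x
    using mult_right_mono[OF A(2)[of x], of "\<bar>k x\<bar>"] by (simp add: power2_eq_square)
  have kb: "(\<lambda>x. (k x)\<^sup>2) \<in> borel_measurable borel" by simp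
  have "\<bar>(k x)\<^sup>2\<bar> \<le> A\<^sup>2" for x using A(2)[of x] by (simp add: abs_le_square_iff[symmetric] A(1))
  then have kb2: "bounded (range (\<lambda>x. (k x)\<^sup>2))"
    unfolding bounded_iff by auto
  have kb3: "integrable lborel (\<lambda>x. (k x)\<^sup>2)"
  proof (rule Bochner_Integration.integrable_bound)
    show "integrable lborel (\<lambda>x. A * \<bar>k x\<bar>)" using k_integrable by simp
    show "AE x in lborel. norm ((k x)\<^sup>2) \<le> norm (A * \<bar>k x\<bar>)"
      using bnd A(1) by (intro AE_I2) (simp add: abs_mult)
  qed simp
  have gb: "(\<lambda>x. \<bar>g x\<bar>) \<in> bdd_meas N" using g by (rule bdd_meas_abs)
  note F = integral_conv_le[OF kb kb2 kb3 _ gb, simplified]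
  have pt: "(conv_on \<Omega> k g x)\<^sup>2 \<le> G * (\<integral>y. (k (x - y))\<^sup>2 * \<bar>g y\<bar> \<partial>N)" for x
  proof -
    have "(conv_on \<Omega> k g x)\<^sup>2 \<le> (\<integral>y. \<bar>k (x - y)\<bar> * \<bar>g y\<bar> \<partial>N)\<^sup>2"
      unfolding conv_on_eq[OF g] using g kernel_bdd_meas by (intro abs_integral_mult_le)
    also have "\<dots> = (\<integral>y. \<bar>g y\<bar> * \<bar>k (x - y)\<bar> \<partial>N)\<^sup>2" by (simp add: mult.commute)
    also have "\<dots> \<le> G * (\<integral>y. \<bar>g y\<bar> * \<bar>k (x - y)\<bar>\<^sup>2 \<partial>N)"
      unfolding G_def
      using g kernel_bdd_meas by (intro weighted_Cauchy_Schwarz_integral bdd_meas_abs) auto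
    finally show ?thesis by (simp add: mult.commute)
  qed
  have "(\<integral>x. (conv_on \<Omega> k g x)\<^sup>2 \<partial>N) \<le> (\<integral>x. G * (\<integral>y. (k (x - y))\<^sup>2 * \<bar>g y\<bar> \<partial>N) \<partial>N)"
    using g F(2) pt by (intro integral_mono integrable_bdd_meas[OF bdd_meas_power2[OF conv_bdd_meas]]) auto
  also have "\<dots> \<le> G * ((\<integral>x. (k x)\<^sup>2 \<partial>lborel) * G)"
    using F(1) G by (simp add: G_def mult_left_mono)
  finally have "L2_seminorm N (conv_on \<Omega> k g) \<le> sqrt (G\<^sup>2 * (\<integral>x. (k x)\<^sup>2 \<partial>lborel))"
    unfolding L2_seminorm_def by (simp add: power2_eq_square mult_ac)
  also have "\<dots> = L2_seminorm lborel k * G" using G by (simp add: real_sqrt_mult L2_seminorm_def)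
  finally show ?thesis by (simp add: G_def)
qed

end

section \<open>Bias and variance\<close>

lemma (in prob_space) expectation_mult_standardized:
  fixes \<xi> :: "'i \<Rightarrow> 'a \<Rightarrow> real"
  assumes indep: "indep_vars (\<lambda>_. borel) \<xi> I"
    and int: "\<And>i. i \<in> I \<Longrightarrow> integrable M (\<xi> i)"
    and mean: "\<And>i. i \<in> I \<Longrightarrow> expectation (\<xi> i) = 0"
    and var: "\<And>i. i \<in> I \<Longrightarrow> variance (\<xi> i) = 1"
    and ij: "i \<in> I" "j \<in> I"
  shows "expectation (\<lambda>\<omega>. \<xi> i \<omega> * \<xi> j \<omega>) = (if i = j then 1 else 0)"
proof (cases "i = j")
  case True
  then show ?thesis using var[of i] mean[of i] ij by (simp add: power2_eq_square)
next
  case False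
  have "indep_vars (\<lambda>_. borel) \<xi> {i, j}"
    using indep by (rule indep_vars_subset) (use ij in auto)
  then have "expectation (\<lambda>\<omega>. \<Prod>k\<in>{i, j}. \<xi> k \<omega>) = (\<Prod>k\<in>{i, j}. expectation (\<xi> k))"
    using ij int by (intro indep_vars_lebesgue_integral) auto
  then show ?thesis using False mean[of i] ij by simp
qed

context finite_measure
begin

text \<open>Separates the coefficients from the integrals over t. When the coefficients are random,
  the expectation can then be taken term by term, with no exchange of the integral over t with the
  expectation.\<close>

lemma integral_affine_combination_power2:
  fixes c :: "'i \<Rightarrow> real"
  assumes b: "b \<in> bdd_meas M" and \<psi>: "\<And>i. i \<in> I \<Longrightarrow> \<psi> i \<in> bdd_meas M"
  shows "(\<integral>t. (b t + (\<Sum>i\<in>I. c i * \<psi> i t))\<^sup>2 \<partial>M) =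
    (\<integral>t. (b t)\<^sup>2 \<partial>M) + 2 * (\<Sum>i\<in>I. c i * (\<integral>t. b t * \<psi> i t \<partial>M))
      + (\<Sum>i\<in>I. \<Sum>j\<in>I. c i * c j * (\<integral>t. \<psi> i t * \<psi> j t \<partial>M))"
proof -
  have "(b t + (\<Sum>i\<in>I. c i * \<psi> i t))\<^sup>2 = (b t)\<^sup>2 + 2 * (\<Sum>i\<in>I. c i * (b t * \<psi> i t))
      + (\<Sum>i\<in>I. \<Sum>j\<in>I. c i * c j * (\<psi> i t * \<psi> j t))" for t
  proof -
    have "(\<Sum>i\<in>I. c i * \<psi> i t)\<^sup>2 = (\<Sum>i\<in>I. \<Sum>j\<in>I. c i * c j * (\<psi> i t * \<psi> j t))"
      unfolding power2_eq_square sum_product by (simp add: mult_ac)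
    moreover have "b t * (\<Sum>i\<in>I. c i * \<psi> i t) = (\<Sum>i\<in>I. c i * (b t * \<psi> i t))"
      by (simp add: sum_distrib_left mult_ac)
    ultimately show ?thesis by (simp add: power2_sum)
  qed
  then have "(\<integral>t. (b t + (\<Sum>i\<in>I. c i * \<psi> i t))\<^sup>2 \<partial>M) = (\<integral>t. (b t)\<^sup>2 + 2 * (\<Sum>i\<in>I. c i * (b t * \<psi> i t))
      + (\<Sum>i\<in>I. \<Sum>j\<in>I. c i * c j * (\<psi> i t * \<psi> j t)) \<partial>M)" by simp
  also have "\<dots> = (\<integral>t. (b t)\<^sup>2 \<partial>M) + 2 * (\<integral>t. (\<Sum>i\<in>I. c i * (b t * \<psi> i t)) \<partial>M)
      + (\<integral>t. (\<Sum>i\<in>I. \<Sum>j\<in>I. c i * c j * (\<psi> i t * \<psi> j t)) \<partial>M)"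
    by (subst Bochner_Integration.integral_add
        | intro integrable_bdd_meas bdd_meas_add bdd_meas_power2 bdd_meas_cmult bdd_meas_sum bdd_meas_mult b \<psi>
        | simp)+
  also have "(\<integral>t. (\<Sum>i\<in>I. c i * (b t * \<psi> i t)) \<partial>M) = (\<Sum>i\<in>I. c i * (\<integral>t. b t * \<psi> i t \<partial>M))"
    by (subst Bochner_Integration.integral_sum)
      (auto intro!: integrable_bdd_meas bdd_meas_cmult bdd_meas_mult b \<psi>)
  also have "(\<integral>t. (\<Sum>i\<in>I. \<Sum>j\<in>I. c i * c j * (\<psi> i t * \<psi> j t)) \<partial>M)
      = (\<Sum>i\<in>I. \<integral>t. (\<Sum>j\<in>I. c i * c j * (\<psi> i t * \<psi> j t)) \<partial>M)"
    by (intro Bochner_Integration.integral_sum integrable_bdd_meas bdd_meas_sum bdd_meas_cmult bdd_meas_mult \<psi>)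
  also have "\<dots> = (\<Sum>i\<in>I. \<Sum>j\<in>I. c i * c j * (\<integral>t. \<psi> i t * \<psi> j t \<partial>M))"
  proof (rule sum.cong[OF refl])
    fix i assume i: "i \<in> I"
    show "(\<integral>t. (\<Sum>j\<in>I. c i * c j * (\<psi> i t * \<psi> j t)) \<partial>M) = (\<Sum>j\<in>I. c i * c j * (\<integral>t. \<psi> i t * \<psi> j t \<partial>M))"
      using i by (subst Bochner_Integration.integral_sum)
        (auto intro!: integrable_bdd_meas bdd_meas_cmult bdd_meas_mult \<psi>)
  qed
  finally show ?thesis .
qed

end

text \<open>In the expanded square the terms linear in the noise have mean zero, and the mixed terms
  vanish off the diagonal because the noise variables are uncorrelated with unit variance.\<close>

lemma bias_variance_decomposition:
  fixes \<xi> :: "'i \<Rightarrow> 'w \<Rightarrow> real" and \<sigma> :: real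
  assumes "finite_measure N" and "prob_space M"
    and I: "finite I"
    and b: "b \<in> bdd_meas N" and \<psi>: "\<And>i. i \<in> I \<Longrightarrow> \<psi> i \<in> bdd_meas N"
    and indep: "prob_space.indep_vars M (\<lambda>_. borel) \<xi> I"
    and int: "\<And>i. i \<in> I \<Longrightarrow> integrable M (\<xi> i)" "\<And>i. i \<in> I \<Longrightarrow> integrable M (\<lambda>\<omega>. (\<xi> i \<omega>)\<^sup>2)"
    and mean: "\<And>i. i \<in> I \<Longrightarrow> prob_space.expectation M (\<xi> i) = 0"
    and var: "\<And>i. i \<in> I \<Longrightarrow> prob_space.variance M (\<xi> i) = 1"
  shows "(\<integral>\<omega>. (L2_seminorm N (\<lambda>t. b t + (\<Sum>i\<in>I. \<sigma> * \<xi> i \<omega> * \<psi> i t)))\<^sup>2 \<partial>M)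
    = (L2_seminorm N b)\<^sup>2 + \<sigma>\<^sup>2 * (\<Sum>i\<in>I. (L2_seminorm N (\<psi> i))\<^sup>2)"
proof -
  interpret N: finite_measure N by fact
  interpret prob_space M by fact
  \<comment> \<open>Products of noise variables are dominated by the sum of their squares, which are
    integrable by assumption.\<close>
  have prod_int: "integrable M (\<lambda>\<omega>. \<xi> i \<omega> * \<xi> j \<omega>)" if "i \<in> I" "j \<in> I" for i j
  proof (rule Bochner_Integration.integrable_bound)
    show "integrable M (\<lambda>\<omega>. (\<xi> i \<omega>)\<^sup>2 + (\<xi> j \<omega>)\<^sup>2)" using int that by simp
    show "(\<lambda>\<omega>. \<xi> i \<omega> * \<xi> j \<omega>) \<in> borel_measurable M"
      using int(1) that by (intro borel_measurable_times) (auto dest: borel_measurable_integrable)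
    have "\<bar>x * y\<bar> \<le> x\<^sup>2 + y\<^sup>2" for x y :: real
      using sum_squares_bound[of "\<bar>x\<bar>" "\<bar>y\<bar>"] mult_nonneg_nonneg[of "\<bar>x\<bar>" "\<bar>y\<bar>"]
      unfolding abs_mult power2_abs by linarith
    then show "AE \<omega> in M. norm (\<xi> i \<omega> * \<xi> j \<omega>) \<le> norm ((\<xi> i \<omega>)\<^sup>2 + (\<xi> j \<omega>)\<^sup>2)" by simp
  qed
  have sq: "(L2_seminorm N g)\<^sup>2 = (\<integral>t. (g t)\<^sup>2 \<partial>N)" for g
    by (simp add: L2_seminorm_def)
  define p where "p i = (\<integral>t. b t * \<psi> i t \<partial>N)" for i
  define q where "q i j = (\<integral>t. \<psi> i t * \<psi> j t \<partial>N)" for i j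
  have "(\<integral>\<omega>. (L2_seminorm N (\<lambda>t. b t + (\<Sum>i\<in>I. \<sigma> * \<xi> i \<omega> * \<psi> i t)))\<^sup>2 \<partial>M) =
      (\<integral>\<omega>. (L2_seminorm N b)\<^sup>2 + (\<Sum>i\<in>I. (2 * \<sigma> * p i) * \<xi> i \<omega>)
        + (\<Sum>i\<in>I. \<Sum>j\<in>I. (\<sigma>\<^sup>2 * q i j) * (\<xi> i \<omega> * \<xi> j \<omega>)) \<partial>M)"
    unfolding sq
    by (subst N.integral_affine_combination_power2[OF b \<psi>])
      (simp_all add: p_def q_def power2_eq_square mult_ac sum_distrib_left)
  also have "\<dots> = (L2_seminorm N b)\<^sup>2 + expectation (\<lambda>\<omega>. \<Sum>i\<in>I. (2 * \<sigma> * p i) * \<xi> i \<omega>)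
      + expectation (\<lambda>\<omega>. \<Sum>i\<in>I. \<Sum>j\<in>I. (\<sigma>\<^sup>2 * q i j) * (\<xi> i \<omega> * \<xi> j \<omega>))"
    using int prod_int by (simp add: prob_space)
  also have "expectation (\<lambda>\<omega>. \<Sum>i\<in>I. (2 * \<sigma> * p i) * \<xi> i \<omega>) = 0"
    using int mean by (subst Bochner_Integration.integral_sum) auto
  also have "expectation (\<lambda>\<omega>. \<Sum>i\<in>I. \<Sum>j\<in>I. (\<sigma>\<^sup>2 * q i j) * (\<xi> i \<omega> * \<xi> j \<omega>))
      = (\<Sum>i\<in>I. \<Sum>j\<in>I. (\<sigma>\<^sup>2 * q i j) * expectation (\<lambda>\<omega>. \<xi> i \<omega> * \<xi> j \<omega>))"
    using prod_int by (simp add: Bochner_Integration.integral_sum)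
  also have "\<dots> = (\<Sum>i\<in>I. \<Sum>j\<in>I. (\<sigma>\<^sup>2 * q i j) * (if i = j then 1 else 0))"
    by (intro sum.cong refl) (simp only: expectation_mult_standardized[OF indep int(1) mean var])
  also have "\<dots> = \<sigma>\<^sup>2 * (\<Sum>i\<in>I. (L2_seminorm N (\<psi> i))\<^sup>2)"
  proof -
    have "q i i = (L2_seminorm N (\<psi> i))\<^sup>2" for i
      unfolding sq q_def by (simp add: power2_eq_square)
    then show ?thesis using I by (simp add: if_distrib sum_distrib_left cong: if_cong)
  qed
  finally show ?thesis by simp
qed

section \<open>Rescaled kernels\<close>

lemma continuous_compact_support_bounded_integrable:
  fixes K :: "'a::euclidean_space \<Rightarrow> real"
  assumes c: "continuous_on UNIV K" and s: "compact (fun_support K)"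
  shows "bounded (range K)" "integrable lborel K"
proof -
  have z: "K x = 0" if "x \<notin> fun_support K" for x
    using that closure_subset[of "{x. K x \<noteq> 0}"] by (auto simp: fun_support_def)
  have cs: "continuous_on (fun_support K) K" using c continuous_on_subset by blast
  have "bounded (insert 0 (K ` fun_support K))"
    using compact_continuous_image[OF cs s] compact_imp_bounded by simp
  then show "bounded (range K)"
    by (rule bounded_subset) (use z in auto)
  have "(\<lambda>x. indicator (fun_support K) x *\<^sub>R K x) = K"
    using z by (intro ext) (metis indicator_simps mult_zero_left mult_1 real_scaleR_def)
  then show "integrable lborel K" using borel_integrable_compact[OF s cs] by simp
qed

text \<open>Substituting x = \<beta> u produces the factor \<open>\<beta> ^ CARD('n)\<close>. It
  cancels the normalisation in the L1 norm, while the squared kernel carries the normalisation twice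
  and keeps one factor in the denominator.\<close>

lemma
  fixes K :: "real ^ 'n::finite \<Rightarrow> real"
  assumes c: "continuous_on UNIV K" and s: "compact (fun_support K)" and \<beta>: "\<beta> > 0"
  shows bounded_range_scaled_kernel: "bounded (range (scaled_kernel K \<beta>))"
    and integrable_scaled_kernel: "integrable lborel (scaled_kernel K \<beta>)"
    and L1_scaled_kernel: "(\<integral>x. \<bar>scaled_kernel K \<beta> x\<bar> \<partial>lborel) = (\<integral>x. \<bar>K x\<bar> \<partial>lborel)"
    and L2_scaled_kernel: "L2_seminorm lborel (scaled_kernel K \<beta>)
      = \<beta> powr (- (real CARD('n) / 2)) * L2_seminorm lborel K"
    and measurable_scaled_kernel: "scaled_kernel K \<beta> \<in> borel_measurable borel"
proof -
  note K = continuous_compact_support_bounded_integrable[OF c s]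
  have Km [measurable]: "K \<in> borel_measurable borel" using c by (rule borel_measurable_continuous_onI)
  show "scaled_kernel K \<beta> \<in> borel_measurable borel" unfolding scaled_kernel_def by simp
  have "bounded ((*\<^sub>R) (1 / \<beta> ^ CARD('n)) ` range K)" using K(1) by (rule bounded_scaling)
  then show "bounded (range (scaled_kernel K \<beta>))"
    by (rule bounded_subset) (auto simp: scaled_kernel_def)
  have i: "integrable lborel (\<lambda>x. K (x /\<^sub>R \<beta>))"
    using lborel_integrable_affine[OF Km, of "inverse \<beta>" 0] \<beta> K(2) by simp
  show "integrable lborel (scaled_kernel K \<beta>)"
    unfolding scaled_kernel_def using i by simp
  have sc: "(\<integral>x. f (K (x /\<^sub>R \<beta>)) \<partial>lborel) = \<beta> ^ CARD('n) * (\<integral>x. f (K x) \<partial>lborel)"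
    if [measurable]: "f \<in> borel_measurable borel" for f :: "real \<Rightarrow> real"
    using lborel_integral_affine[of "\<lambda>x. f (K x)" "inverse \<beta>" 0] \<beta> by (simp add: power_inverse field_simps)
  show "(\<integral>x. \<bar>scaled_kernel K \<beta> x\<bar> \<partial>lborel) = (\<integral>x. \<bar>K x\<bar> \<partial>lborel)"
    using sc[of abs] \<beta> by (simp add: scaled_kernel_def)
  have "(\<integral>x. (scaled_kernel K \<beta> x)\<^sup>2 \<partial>lborel) = (\<integral>x. (K x)\<^sup>2 \<partial>lborel) / \<beta> ^ CARD('n)"
    using sc[of "\<lambda>x. x\<^sup>2"] \<beta> by (simp add: scaled_kernel_def power_divide power2_eq_square)
  then have "L2_seminorm lborel (scaled_kernel K \<beta>) = L2_seminorm lborel K / sqrt (\<beta> ^ CARD('n))"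
    by (simp add: L2_seminorm_def real_sqrt_divide)
  also have "sqrt (\<beta> ^ CARD('n)) = \<beta> powr (real CARD('n) / 2)"
    using \<beta> by (simp add: powr_half_sqrt[symmetric] powr_realpow[symmetric] powr_powr)
  finally show "L2_seminorm lborel (scaled_kernel K \<beta>)
      = \<beta> powr (- (real CARD('n) / 2)) * L2_seminorm lborel K"
    by (simp add: powr_minus field_simps)
qed

section \<open>Asymptotic relations\<close>

lemma lesssim_on_ereal_iff:
  "lesssim_on I (\<lambda>i. ereal (u i)) (\<lambda>i. ereal (v i)) \<longleftrightarrow> (\<exists>C>0. \<forall>i\<in>I. u i \<le> C * v i)"
  by (simp add: lesssim_on_def)

lemma lesssim_on_trans:
  assumes "lesssim_on I u v" "lesssim_on I v w"
  shows "lesssim_on I u w"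
proof -
  obtain C where C: "C > 0" "\<And>i. i \<in> I \<Longrightarrow> u i \<le> ereal C * v i"
    using assms(1) by (auto simp: lesssim_on_def)
  obtain D where D: "D > 0" "\<And>i. i \<in> I \<Longrightarrow> v i \<le> ereal D * w i"
    using assms(2) by (auto simp: lesssim_on_def)
  have "u i \<le> ereal (C * D) * w i" if "i \<in> I" for i
  proof -
    have "u i \<le> ereal C * v i" using C that by simp
    also have "\<dots> \<le> ereal C * (ereal D * w i)" using C D that by (intro ereal_mult_left_mono) auto
    finally show ?thesis by (simp add: mult.assoc[symmetric])
  qed
  then show ?thesis using C D unfolding lesssim_on_def by (intro exI[of _ "C * D"]) auto
qed

lemma sim_on_trans: "sim_on I u v \<Longrightarrow> sim_on I v w \<Longrightarrow> sim_on I u w"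
  by (auto simp: sim_on_def intro: lesssim_on_trans)

lemma lesssim_on_powr:
  assumes "lesssim_on I (\<lambda>i. ereal (u i)) (\<lambda>i. ereal (v i))"
    and "\<And>i. i \<in> I \<Longrightarrow> u i \<ge> 0" "\<And>i. i \<in> I \<Longrightarrow> v i \<ge> 0" and p: "p \<ge> 0"
  shows "lesssim_on I (\<lambda>i. ereal (u i powr p)) (\<lambda>i. ereal (v i powr p))"
proof -
  obtain C where C: "C > 0" "\<And>i. i \<in> I \<Longrightarrow> u i \<le> C * v i"
    using assms(1) by (auto simp: lesssim_on_ereal_iff)
  have "u i powr p \<le> C powr p * v i powr p" if "i \<in> I" for i
    using powr_mono2[OF p _ C(2)[OF that]] assms(2,3) that C(1) by (simp add: powr_mult)
  then show ?thesis using C(1) unfolding lesssim_on_ereal_iff by (intro exI[of _ "C powr p"]) auto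
qed

lemma sim_on_powr:
  assumes "sim_on I (\<lambda>i. ereal (u i)) (\<lambda>i. ereal (v i))"
    and "\<And>i. i \<in> I \<Longrightarrow> u i \<ge> 0" "\<And>i. i \<in> I \<Longrightarrow> v i \<ge> 0" and "p \<ge> 0"
  shows "sim_on I (\<lambda>i. ereal (u i powr p)) (\<lambda>i. ereal (v i powr p))"
  using assms by (auto simp: sim_on_def intro: lesssim_on_powr)

lemma lesssim_on_mult:
  assumes "lesssim_on I (\<lambda>i. ereal (u i)) (\<lambda>i. ereal (v i))"
    and "lesssim_on I (\<lambda>i. ereal (u' i)) (\<lambda>i. ereal (v' i))"
    and "\<And>i. i \<in> I \<Longrightarrow> u' i \<ge> 0" "\<And>i. i \<in> I \<Longrightarrow> v i \<ge> 0"
  shows "lesssim_on I (\<lambda>i. ereal (u i * u' i)) (\<lambda>i. ereal (v i * v' i))"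
proof -
  obtain C where C: "C > 0" "\<And>i. i \<in> I \<Longrightarrow> u i \<le> C * v i"
    using assms(1) by (auto simp: lesssim_on_ereal_iff)
  obtain D where D: "D > 0" "\<And>i. i \<in> I \<Longrightarrow> u' i \<le> D * v' i"
    using assms(2) by (auto simp: lesssim_on_ereal_iff)
  have "u i * u' i \<le> (C * D) * (v i * v' i)" if "i \<in> I" for i
  proof -
    have "u i * u' i \<le> (C * v i) * (D * v' i)"
      using C D assms(3,4) that by (intro mult_mono) (auto intro: less_imp_le)
    then show ?thesis by (simp add: mult_ac)
  qed
  then show ?thesis using C(1) D(1) unfolding lesssim_on_ereal_iff by (intro exI[of _ "C * D"]) auto
qed

lemma sim_on_mult:
  assumes "sim_on I (\<lambda>i. ereal (u i)) (\<lambda>i. ereal (v i))"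
    and "sim_on I (\<lambda>i. ereal (u' i)) (\<lambda>i. ereal (v' i))"
    and "\<And>i. i \<in> I \<Longrightarrow> u i \<ge> 0" "\<And>i. i \<in> I \<Longrightarrow> v i \<ge> 0"
    and "\<And>i. i \<in> I \<Longrightarrow> u' i \<ge> 0" "\<And>i. i \<in> I \<Longrightarrow> v' i \<ge> 0"
  shows "sim_on I (\<lambda>i. ereal (u i * u' i)) (\<lambda>i. ereal (v i * v' i))"
  using assms by (auto simp: sim_on_def intro: lesssim_on_mult)

lemma lesssim_on_powr_nat:
  assumes "a \<le> b"
  shows "lesssim_on {1..} (\<lambda>n. ereal (real n powr a)) (\<lambda>n. ereal (real n powr b))"
  unfolding lesssim_on_ereal_iff using assms by (intro exI[of _ 1]) (auto intro: powr_mono)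

text \<open>A lower bound valid from some index on extends to all indices: the finitely many
  exceptions are absorbed into the constant, since \<open>u\<close> is strictly positive at each of
  them. The value infinity of \<open>u\<close> is allowed.\<close>

lemma lesssim_on_eventually:
  fixes v :: "nat \<Rightarrow> real"
  assumes c: "c > 0" and ev: "\<And>n. n \<ge> m \<Longrightarrow> ereal (c * v n) \<le> u n"
    and pos: "\<And>n. n \<ge> 1 \<Longrightarrow> u n > 0"
  shows "lesssim_on {1..} (\<lambda>n. ereal (v n)) u"
proof -
  have "\<exists>C>0. ereal (v n) \<le> ereal C * u n" if "n \<ge> 1" for n
  proof (cases "u n")
    case (real r)
    then have "r > 0" using pos[OF that] by simp
    then have "ereal (v n) \<le> ereal (\<bar>v n\<bar> / r + 1) * u n"
      using real mult_left_mono[OF abs_ge_self[of "v n"], of r] by (simp add: field_simps add_increasing)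
    moreover have "\<bar>v n\<bar> / r + 1 > 0" using \<open>r > 0\<close> by (simp add: add_nonneg_pos)
    ultimately show ?thesis by blast
  next
    case PInf
    then show ?thesis by (intro exI[of _ 1]) auto
  next
    case MInf
    then show ?thesis using pos[OF that] by simp
  qed
  then obtain C where C: "\<And>n. n \<ge> 1 \<Longrightarrow> C n > 0" "\<And>n. n \<ge> 1 \<Longrightarrow> ereal (v n) \<le> ereal (C n) * u n"
    by metis
  \<comment> \<open>The first summand serves the indices from \<open>m\<close> on; the sum dominates
    each individual constant below \<open>m\<close>.\<close>
  define D where "D = 1 / c + (\<Sum>n\<in>{1..<m}. C n)"
  have Dc: "D \<ge> 1 / c" unfolding D_def using C(1) by (auto intro!: sum_nonneg intro: less_imp_le)
  have "ereal (v n) \<le> ereal D * u n" if n: "n \<ge> 1" for n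
  proof (cases "n \<ge> m")
    case True
    have "ereal (v n) = ereal (1 / c) * ereal (c * v n)" using c by simp
    also have "\<dots> \<le> ereal (1 / c) * u n" using c ev[OF True] by (intro ereal_mult_left_mono) auto
    also have "\<dots> \<le> ereal D * u n" using Dc pos[OF n] by (intro ereal_mult_right_mono) auto
    finally show ?thesis .
  next
    case False
    have "C n \<le> (\<Sum>n\<in>{1..<m}. C n)" using False n C(1) by (intro member_le_sum) (auto intro: less_imp_le)
    then have "C n \<le> D" using c by (simp add: D_def add_increasing)
    have "ereal (v n) \<le> ereal (C n) * u n" using C n by simp
    also have "\<dots> \<le> ereal D * u n" using \<open>C n \<le> D\<close> pos[OF n] by (intro ereal_mult_right_mono) auto
    finally show ?thesis .
  qed
  moreover have "D > 0" using Dc c by (meson divide_pos_pos less_le_trans zero_less_one)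
  ultimately show ?thesis unfolding lesssim_on_def by auto
qed

lemma lesssim_on_mono: "(\<And>i. i \<in> I \<Longrightarrow> u i \<le> v i) \<Longrightarrow> lesssim_on I u v"
  unfolding lesssim_on_def by (intro exI[of _ 1]) (simp add: one_ereal_def[symmetric])

lemma lesssim_on_compose:
  "lesssim_on J u v \<Longrightarrow> (\<And>i. i \<in> I \<Longrightarrow> g i \<in> J) \<Longrightarrow> lesssim_on I (\<lambda>i. u (g i)) (\<lambda>i. v (g i))"
  unfolding lesssim_on_def by blast

lemma sim_on_compose:
  "sim_on J u v \<Longrightarrow> (\<And>i. i \<in> I \<Longrightarrow> g i \<in> J) \<Longrightarrow> sim_on I (\<lambda>i. u (g i)) (\<lambda>i. v (g i))"
  by (auto simp: sim_on_def intro: lesssim_on_compose)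

lemma sim_on_cong:
  "sim_on I u v \<Longrightarrow> (\<And>i. i \<in> I \<Longrightarrow> u i = u' i) \<Longrightarrow> (\<And>i. i \<in> I \<Longrightarrow> v i = v' i) \<Longrightarrow> sim_on I u' v'"
  unfolding sim_on_def lesssim_on_def by simp

lemma lesssim_on_add:
  assumes "lesssim_on I u (\<lambda>i. ereal (w i))" "lesssim_on I v (\<lambda>i. ereal (w i))"
  shows "lesssim_on I (\<lambda>i. u i + v i) (\<lambda>i. ereal (w i))"
proof -
  obtain C where C: "C > 0" "\<And>i. i \<in> I \<Longrightarrow> u i \<le> ereal (C * w i)"
    using assms(1) by (auto simp: lesssim_on_def)
  obtain D where D: "D > 0" "\<And>i. i \<in> I \<Longrightarrow> v i \<le> ereal (D * w i)"
    using assms(2) by (auto simp: lesssim_on_def)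
  have "u i + v i \<le> ereal (C + D) * ereal (w i)" if "i \<in> I" for i
    using add_mono[OF C(2) D(2), OF that that] by (simp add: distrib_right)
  then show ?thesis using C(1) D(1) unfolding lesssim_on_def by (intro exI[of _ "C + D"]) auto
qed

lemma lesssim_on_cmult:
  assumes "lesssim_on I u (\<lambda>i. ereal (w i))" "c \<ge> 0" "\<And>i. i \<in> I \<Longrightarrow> w i \<ge> 0"
  shows "lesssim_on I (\<lambda>i. ereal c * u i) (\<lambda>i. ereal (w i))"
proof -
  obtain C where C: "C > 0" "\<And>i. i \<in> I \<Longrightarrow> u i \<le> ereal (C * w i)"
    using assms(1) by (auto simp: lesssim_on_def)
  \<comment> \<open>The added 1 keeps the constant positive when \<open>c = 0\<close>.\<close>
  have "ereal c * u i \<le> ereal (c * C + 1) * ereal (w i)" if "i \<in> I" for i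
  proof -
    have "ereal c * u i \<le> ereal c * ereal (C * w i)"
      using C(2)[OF that] assms(2) by (intro ereal_mult_left_mono) auto
    also have "\<dots> \<le> ereal (c * C + 1) * ereal (w i)" using assms(3)[OF that] by (simp add: algebra_simps)
    finally show ?thesis .
  qed
  moreover have "c * C + 1 > 0" using C(1) assms(2) by (simp add: add_nonneg_pos)
  ultimately show ?thesis unfolding lesssim_on_def by blast
qed

lemma lesssim_on_powr_minus:
  assumes "lesssim_on I (\<lambda>i. ereal (u i)) (\<lambda>i. ereal (v i))"
    and u: "\<And>i. i \<in> I \<Longrightarrow> u i > 0" and v: "\<And>i. i \<in> I \<Longrightarrow> v i > 0" and "p \<ge> 0"
  shows "lesssim_on I (\<lambda>i. ereal (v i powr (- p))) (\<lambda>i. ereal (u i powr (- p)))"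
proof -
  obtain C where C: "C > 0" "\<And>i. i \<in> I \<Longrightarrow> u i powr p \<le> C * v i powr p"
    using lesssim_on_powr[OF assms(1) _ _ assms(4)] u v by (auto simp: lesssim_on_ereal_iff less_imp_le)
  have "v i powr (- p) \<le> C * u i powr (- p)" if "i \<in> I" for i
    using C(2)[OF that] u[OF that] v[OF that] by (simp add: powr_minus field_simps)
  then show ?thesis using C(1) by (auto simp: lesssim_on_ereal_iff)
qed

text \<open>The hypotheses place \<open>e\<close> between the larger of \<open>A\<close> and
  \<open>v\<close> and their sum, so it has the order of the larger one. For n at least 1 this is
  the power with the larger exponent.\<close>

lemma sim_on_powr_max:
  fixes A e :: "nat \<Rightarrow> ereal" and v :: "nat \<Rightarrow> real"
  assumes A: "sim_on {1..} A (\<lambda>n. ereal (real n powr p))"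
    and v: "sim_on {1..} (\<lambda>n. ereal (v n)) (\<lambda>n. ereal (real n powr q))"
    and le: "\<And>n. n \<ge> 1 \<Longrightarrow> A n \<le> e n" "\<And>n. n \<ge> 1 \<Longrightarrow> ereal (v n) \<le> e n"
      "\<And>n. n \<ge> 1 \<Longrightarrow> e n \<le> A n + ereal (v n)"
  shows "sim_on {1..} e (\<lambda>n. ereal (real n powr max p q))"
proof -
  have "lesssim_on {1..} A (\<lambda>n. ereal (real n powr max p q))"
    using A lesssim_on_trans[OF _ lesssim_on_powr_nat[OF max.cobounded1]] unfolding sim_on_def by blast
  moreover have "lesssim_on {1..} (\<lambda>n. ereal (v n)) (\<lambda>n. ereal (real n powr max p q))"
    using v lesssim_on_trans[OF _ lesssim_on_powr_nat[OF max.cobounded2]] unfolding sim_on_def by blast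
  ultimately have "lesssim_on {1..} (\<lambda>n. A n + ereal (v n)) (\<lambda>n. ereal (real n powr max p q))"
    by (rule lesssim_on_add)
  with lesssim_on_mono have 1: "lesssim_on {1..} e (\<lambda>n. ereal (real n powr max p q))"
    by (rule lesssim_on_trans) (use le(3) in simp)
  have "lesssim_on {1..} A e" "lesssim_on {1..} (\<lambda>n. ereal (v n)) e"
    using le by (auto intro!: lesssim_on_mono)
  then have "lesssim_on {1..} (\<lambda>n. ereal (real n powr p)) e" "lesssim_on {1..} (\<lambda>n. ereal (real n powr q)) e"
    using A v lesssim_on_trans unfolding sim_on_def by blast+
  then have 2: "lesssim_on {1..} (\<lambda>n. ereal (real n powr max p q)) e"
    by (simp add: max_def)
  show ?thesis using 1 2 by (simp add: sim_on_def)
qed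

lemma eventually_powr_minus_le:
  assumes "q > 0" "c > 0"
  shows "eventually (\<lambda>n. real n powr (- q) \<le> c) sequentially"
proof -
  have "(\<lambda>n. real n powr (- q)) \<longlonglongrightarrow> 0"
    using assms filterlim_real_sequentially by (intro tendsto_neg_powr) auto
  then show ?thesis using assms(2)
    by (auto dest!: order_tendstoD(2) elim!: eventually_mono)
qed

section \<open>Errors of noisy reconstructions\<close>

text \<open>Pointwise, \<open>sqrt ((b f)\<^sup>2 + v\<^sup>2)\<close> lies between the maximum and
  the sum of \<open>b f\<close> and \<open>v\<close>. The noise part \<open>v\<close> does not
  depend on \<open>f\<close>, so only the bias is maximised. Nonemptiness matters for the second
  bound: an empty supremum is minus infinity.\<close>

lemma SUP_sqrt_power2_add:
  fixes b :: "'f \<Rightarrow> real"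
  assumes F: "F \<noteq> {}" and b: "\<And>f. f \<in> F \<Longrightarrow> b f \<ge> 0" and v: "v \<ge> 0"
  shows "(SUP f\<in>F. ereal (b f)) \<le> (SUP f\<in>F. ereal (sqrt ((b f)\<^sup>2 + v\<^sup>2)))"
    and "ereal v \<le> (SUP f\<in>F. ereal (sqrt ((b f)\<^sup>2 + v\<^sup>2)))"
    and "(SUP f\<in>F. ereal (sqrt ((b f)\<^sup>2 + v\<^sup>2))) \<le> (SUP f\<in>F. ereal (b f)) + ereal v"
proof -
  show "(SUP f\<in>F. ereal (b f)) \<le> (SUP f\<in>F. ereal (sqrt ((b f)\<^sup>2 + v\<^sup>2)))"
    by (intro SUP_mono') (simp add: real_le_rsqrt)
  obtain f where "f \<in> F" using F by blast
  have "ereal v \<le> ereal (sqrt ((b f)\<^sup>2 + v\<^sup>2))" by (simp add: real_le_rsqrt)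
  then show "ereal v \<le> (SUP f\<in>F. ereal (sqrt ((b f)\<^sup>2 + v\<^sup>2)))"
    using \<open>f \<in> F\<close> by (rule SUP_upper2[rotated])
  show "(SUP f\<in>F. ereal (sqrt ((b f)\<^sup>2 + v\<^sup>2))) \<le> (SUP f\<in>F. ereal (b f)) + ereal v"
  proof (rule SUP_least)
    fix f assume f: "f \<in> F"
    have "sqrt ((b f)\<^sup>2 + v\<^sup>2) \<le> b f + v" using b[OF f] v by (rule sqrt_sum_squares_le_sum)
    then have "ereal (sqrt ((b f)\<^sup>2 + v\<^sup>2)) \<le> ereal (b f) + ereal v" by simp
    also have "\<dots> \<le> (SUP f\<in>F. ereal (b f)) + ereal v" using f by (intro add_right_mono SUP_upper)
    finally show "ereal (sqrt ((b f)\<^sup>2 + v\<^sup>2)) \<le> (SUP f\<in>F. ereal (b f)) + ereal v" .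
  qed
qed

lemma sqrt_sum_power2_bounds:
  fixes a :: "nat \<Rightarrow> real"
  shows "(\<And>i. i \<in> {1..n} \<Longrightarrow> 0 \<le> a i \<and> a i \<le> B) \<Longrightarrow> sqrt (\<Sum>i=1..n. (a i)\<^sup>2) \<le> real n powr (1/2) * B"
    and "(\<And>i. i \<in> {1..n} \<Longrightarrow> B \<le> a i) \<Longrightarrow> B \<ge> 0 \<Longrightarrow> real n powr (1/2) * B \<le> sqrt (\<Sum>i=1..n. (a i)\<^sup>2)"
proof -
  have eq: "real n powr (1/2) * B = sqrt (real n * B\<^sup>2)" if "B \<ge> 0"
    using that by (simp add: powr_half_sqrt real_sqrt_mult)
  {
    assume a: "\<And>i. i \<in> {1..n} \<Longrightarrow> 0 \<le> a i \<and> a i \<le> B"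
    show "sqrt (\<Sum>i=1..n. (a i)\<^sup>2) \<le> real n powr (1/2) * B"
    \<comment> \<open>The sign of \<open>B\<close> is read off from the first term of the sum; for
      \<open>n = 0\<close> both sides vanish.\<close>
    proof (cases "n = 0")
      case False
      then have "B \<ge> 0" using a[of 1] by simp
      moreover have "(\<Sum>i=1..n. (a i)\<^sup>2) \<le> (\<Sum>i=1..n. B\<^sup>2)"
        using a by (intro sum_mono power_mono) auto
      ultimately show ?thesis by (simp add: eq)
    qed simp
  }
  assume a: "\<And>i. i \<in> {1..n} \<Longrightarrow> B \<le> a i" and B: "B \<ge> 0"
  have "(\<Sum>i=1..n. B\<^sup>2) \<le> (\<Sum>i=1..n. (a i)\<^sup>2)"
    using a B by (intro sum_mono power_mono) auto
  then show "real n powr (1/2) * B \<le> sqrt (\<Sum>i=1..n. (a i)\<^sup>2)" using B by (simp add: eq)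
qed

text \<open>Treats both errors at once: \<open>T\<close> is the reconstruction or its
  regularisation, with \<open>\<psi>\<close> the basis functions or their convolutions. By linearity
  the noise only adds a random combination of the \<open>\<psi> i\<close> to the deterministic
  error.\<close>

lemma (in bounded_open_set) expected_sq_error:
  fixes \<psi> :: "nat \<Rightarrow> 'a \<Rightarrow> real"
  assumes prob: "prob_space M"
    and f: "f \<in> bdd_meas N" and \<psi>: "\<And>i. i \<in> {1..n} \<Longrightarrow> \<psi> i \<in> bdd_meas N"
    and indep: "prob_space.indep_vars M (\<lambda>_. borel) \<xi> {1..n}"
    and int: "\<And>i. i \<in> {1..n} \<Longrightarrow> integrable M (\<xi> i) \<and> integrable M (\<lambda>\<omega>. (\<xi> i \<omega>)\<^sup>2)"
    and mean: "\<And>i. i \<in> {1..n} \<Longrightarrow> prob_space.expectation M (\<xi> i) = 0"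
    and var: "\<And>i. i \<in> {1..n} \<Longrightarrow> prob_space.variance M (\<xi> i) = 1"
    and L: "\<And>z t. T z t = (\<Sum>i=1..n. z i * \<psi> i t)"
  shows "(\<integral>\<omega>. (l2norm \<Omega> (\<lambda>t. T (\<lambda>i. y i + \<sigma> * \<xi> i \<omega>) t - f t))\<^sup>2 \<partial>M)
    = (l2norm \<Omega> (\<lambda>t. T y t - f t))\<^sup>2 + (\<sigma> * sqrt (\<Sum>i=1..n. (l2norm \<Omega> (\<psi> i))\<^sup>2))\<^sup>2"
proof -
  let ?b = "\<lambda>t. (\<Sum>i=1..n. y i * \<psi> i t) - f t"
  have b: "?b \<in> bdd_meas N" using f \<psi> by (intro bdd_meas_diff bdd_meas_sum bdd_meas_cmult) auto
  have eq: "T (\<lambda>i. y i + \<sigma> * \<xi> i \<omega>) t - f t = ?b t + (\<Sum>i=1..n. \<sigma> * \<xi> i \<omega> * \<psi> i t)" for \<omega> t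
    by (simp add: L sum.distrib algebra_simps)
  have "l2norm \<Omega> (\<lambda>t. T (\<lambda>i. y i + \<sigma> * \<xi> i \<omega>) t - f t)
      = L2_seminorm N (\<lambda>t. ?b t + (\<Sum>i=1..n. \<sigma> * \<xi> i \<omega> * \<psi> i t))" for \<omega>
    unfolding eq using b \<psi> by (intro l2norm_eq bdd_meas_add bdd_meas_sum bdd_meas_cmult) auto
  moreover have "(\<integral>\<omega>. (L2_seminorm N (\<lambda>t. ?b t + (\<Sum>i=1..n. \<sigma> * \<xi> i \<omega> * \<psi> i t)))\<^sup>2 \<partial>M)
      = (L2_seminorm N ?b)\<^sup>2 + \<sigma>\<^sup>2 * (\<Sum>i=1..n. (L2_seminorm N (\<psi> i))\<^sup>2)"
    by (rule bias_variance_decomposition[OF finite_measure_axioms prob _ b \<psi> indep _ _ mean var]) (use int in auto)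
  moreover have "l2norm \<Omega> (\<lambda>t. T y t - f t) = L2_seminorm N ?b"
    unfolding L by (rule l2norm_eq[OF b])
  moreover have "(\<Sum>i=1..n. (l2norm \<Omega> (\<psi> i))\<^sup>2) = (\<Sum>i=1..n. (L2_seminorm N (\<psi> i))\<^sup>2)"
    using \<psi> by (intro sum.cong) (simp_all add: l2norm_eq)
  ultimately show ?thesis
    by (simp add: power_mult_distrib sum_nonneg)
qed

theorem theorem2:
  fixes \<Omega> :: "(real ^ 'n::finite) set"
    and x :: "nat \<Rightarrow> nat \<Rightarrow> real ^ 'n"
    and \<phi> :: "nat \<Rightarrow> nat \<Rightarrow> real ^ 'n \<Rightarrow> real"
    and h :: "nat \<Rightarrow> real"
    and K :: "real ^ 'n \<Rightarrow> real"
    and M :: "'w measure"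
    and \<xi> :: "nat \<Rightarrow> nat \<Rightarrow> 'w \<Rightarrow> real"
    and s_a s R lam lam_M d :: real
    and s_r :: nat
    and \<sigma> :: "nat \<Rightarrow> real"
    and \<beta>_star :: "real \<Rightarrow> nat \<Rightarrow> real"
    and e_reg e_noreg :: "nat \<Rightarrow> ereal"
  defines "d \<equiv> real CARD('n)"
    and "lam_M \<equiv> s_a + d / 2 * (s_a / real s_r - 1)"
    and "e_reg \<equiv> (\<lambda>n. err_reg \<Omega> x \<phi> K M \<xi> s R (\<beta>_star (\<sigma> n) n) (\<sigma> n) n)"
    and "e_noreg \<equiv> (\<lambda>n. err_noreg \<Omega> x \<phi> M \<xi> s R (\<sigma> n) n)"
  assumes domain: "open \<Omega>" "connected \<Omega>" "bounded \<Omega>" "\<Omega> \<noteq> {}" "smooth_boundary \<Omega>"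
    and nodes: "\<And>n i. 1 \<le> i \<Longrightarrow> i \<le> n \<Longrightarrow> x n i \<in> closure \<Omega>"
    and basis_cont: "\<And>n i. 1 \<le> i \<Longrightarrow> i \<le> n \<Longrightarrow> continuous_on (closure \<Omega>) (\<phi> n i)"
    and h_pos: "\<And>n. n \<ge> 1 \<Longrightarrow> h n > 0"
    and h_sim: "sim_on {1..} (\<lambda>n. ereal (h n)) (\<lambda>n. ereal (real n powr (- 1 / d)))"
    and basis_L2: "sim_on {(n, i). 1 \<le> i \<and> i \<le> n}
          (\<lambda>(n, i). ereal (l2norm \<Omega> (\<phi> n i))) (\<lambda>(n, i). ereal (h n powr (d / 2)))"
    and basis_L1: "sim_on {(n, i). 1 \<le> i \<and> i \<le> n}
          (\<lambda>(n, i). ereal (l1norm \<Omega> (\<phi> n i))) (\<lambda>(n, i). ereal (h n powr d))"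
    and s_a_pos: "s_a > 0"
    and approx: "\<And>s R. s \<ge> s_a \<Longrightarrow> s > d / 2 \<Longrightarrow> R > 0 \<Longrightarrow>
          sim_on {1..} (approx_err \<Omega> x \<phi> s R) (\<lambda>n. ereal (h n powr s_a))"
    and K_smooth: "smooth_on K UNIV"
    and K_supp: "compact (fun_support K)"
    and K_int: "(\<integral>t. K t \<partial>lebesgue) = 1"
    and s_r_ge: "s_r \<ge> 2"
    and K_moments: "\<And>r. 1 \<le> mi_size r \<Longrightarrow> mi_size r \<le> s_r - 1 \<Longrightarrow>
          (\<integral>t. monomial_mi r t * K t \<partial>lebesgue) = 0"
    and K_moment_s_r: "\<exists>r. mi_size r = s_r \<and> (\<integral>t. monomial_mi r t * K t \<partial>lebesgue) \<noteq> 0"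
    and smoothing_upper: "\<And>s R. s \<ge> real s_r \<Longrightarrow> s > d / 2 \<Longrightarrow> R > 0 \<Longrightarrow>
          lesssim_on {0<..} (smoothing_err \<Omega> K s R) (\<lambda>\<beta>. ereal (\<beta> ^ s_r))"
    and smoothing_lower: "\<And>s R. s \<ge> real s_r \<Longrightarrow> s > d / 2 \<Longrightarrow> R > 0 \<Longrightarrow>
          \<exists>\<beta>0>0. lesssim_on {0<..\<beta>0} (\<lambda>\<beta>. ereal (\<beta> ^ s_r)) (smoothing_err \<Omega> K s R)"
    and prob: "prob_space M"
    and noise_indep: "\<And>n. n \<ge> 1 \<Longrightarrow> prob_space.indep_vars M (\<lambda>_. borel) (\<xi> n) {1..n}"
    and noise_integrable: "\<And>n i. 1 \<le> i \<Longrightarrow> i \<le> n \<Longrightarrow>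
          integrable M (\<xi> n i) \<and> integrable M (\<lambda>\<omega>. (\<xi> n i \<omega>)\<^sup>2)"
    and noise_mean: "\<And>n i. 1 \<le> i \<Longrightarrow> i \<le> n \<Longrightarrow> prob_space.expectation M (\<xi> n i) = 0"
    and noise_var: "\<And>n i. 1 \<le> i \<Longrightarrow> i \<le> n \<Longrightarrow> prob_space.variance M (\<xi> n i) = 1"
    and s_a_gt: "s_a > real s_r"
    and s_ge: "s \<ge> s_a" and s_gt: "s > d / 2"
    and R_pos: "R > 0"
    and lam_nonneg: "lam \<ge> 0"
    and \<sigma>_pos: "\<And>n. n \<ge> 1 \<Longrightarrow> \<sigma> n > 0"
    and \<sigma>_sim: "sim_on {1..} (\<lambda>n. ereal (\<sigma> n)) (\<lambda>n. ereal (real n powr (- lam / d)))"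
    and \<beta>_pos: "\<And>\<tau> n. \<tau> > 0 \<Longrightarrow> n \<ge> 1 \<Longrightarrow> \<beta>_star \<tau> n > 0"
    and \<beta>_sim: "sim_on ({0<..} \<times> {1..})
          (\<lambda>(\<tau>, n). ereal (\<beta>_star \<tau> n))
          (\<lambda>(\<tau>, n). ereal (\<tau> powr (2 / (2 * real s_r + d)) *
                             real n powr (- 1 / (2 * real s_r + d))))"
  shows "(lam \<le> s_a \<longrightarrow>
            sim_on {1..} e_reg
              (\<lambda>n. ereal (real n powr (- ((2 * lam + d) / (2 * real s_r + d) * (real s_r / d))))) \<and>
            sim_on {1..} e_noreg (\<lambda>n. ereal (real n powr (- lam / d)))) \<and>
         (s_a < lam \<and> lam < lam_M \<longrightarrow>
            sim_on {1..} e_reg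
              (\<lambda>n. ereal (real n powr (- ((2 * lam + d) / (2 * real s_r + d) * (real s_r / d))))) \<and>
            sim_on {1..} e_noreg (\<lambda>n. ereal (real n powr (- s_a / d)))) \<and>
         (lam_M \<le> lam \<longrightarrow>
            lesssim_on {1..} e_reg (\<lambda>n. ereal (real n powr (- s_a / d))) \<and>
            sim_on {1..} e_noreg (\<lambda>n. ereal (real n powr (- s_a / d))))"
proof -

  \<comment> \<open>The function class and the powers of the mesh size\<close>
  interpret bounded_open_set \<Omega> using domain by unfold_locales auto
  have d: "d > 0" by (simp add: d_def)
  have sr: "real s_r > 0" using s_r_ge by simp
  have s_sr: "s \<ge> real s_r" using s_ge s_a_gt by simp
  define D where "D = 2 * real s_r + d"
  have D: "D > 0" using d by (simp add: D_def add_nonneg_pos)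
  define F where "F = sobolev_ball \<Omega> s R"
  have F_bdd: "f \<in> bdd_meas N" if "f \<in> F" for f
    using that by (auto simp: F_def sobolev_ball_def intro: bdd_meas_continuous_on_closure)
  have \<phi>_bdd: "\<phi> n i \<in> bdd_meas N" if "i \<in> {1..n}" for n i
    using that basis_cont by (auto intro: bdd_meas_continuous_on_closure)
  have \<sigma>_nn: "\<sigma> n \<ge> 0" if "n \<ge> 1" for n using \<sigma>_pos[OF that] by simp

  have h_powr: "sim_on {1..} (\<lambda>n. ereal (h n powr p)) (\<lambda>n. ereal (real n powr (- p / d)))" if "p \<ge> 0" for p
  proof -
    have "sim_on {1..} (\<lambda>n. ereal (h n powr p)) (\<lambda>n. ereal ((real n powr (- 1 / d)) powr p))"
      using h_pos that by (intro sim_on_powr[OF h_sim]) (auto intro: less_imp_le)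
    then show ?thesis by (simp add: powr_powr)
  qed
  have approx': "sim_on {1..} (approx_err \<Omega> x \<phi> s R) (\<lambda>n. ereal (real n powr (- s_a / d)))"
    using approx[OF s_ge s_gt R_pos] h_powr[of s_a] s_a_pos by (auto intro: sim_on_trans)
  \<comment> \<open>Over an empty class the approximation error would be minus infinity,
    contradicting its lower bound at n = 1.\<close>
  have F_ne: "F \<noteq> {}"
  proof
    assume "F = {}"
    then have "approx_err \<Omega> x \<phi> s R 1 = - \<infinity>" by (simp add: approx_err_def F_def bot_ereal_def)
    moreover obtain C where "C > 0" "\<And>n. n \<ge> 1 \<Longrightarrow> ereal (real n powr (- s_a / d)) \<le> ereal C * approx_err \<Omega> x \<phi> s R n"
      using approx' by (auto simp: sim_on_def lesssim_on_def)
    ultimately show False by fastforce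
  qed

  \<comment> \<open>The error without regularisation\<close>
  define v0 where "v0 n = \<sigma> n * sqrt (\<Sum>i=1..n. (l2norm \<Omega> (\<phi> n i))\<^sup>2)" for n
  have h_half: "sim_on {1..} (\<lambda>n. ereal (h n powr (d / 2))) (\<lambda>n. ereal (real n powr (- (1 / 2))))"
    using h_powr[of "d / 2"] d by simp
  \<comment> \<open>Each of the n squared norms is of order h to the power d, that is 1/n, uniformly
    in i; so the sum is of order 1 and \<open>v0\<close> has the order of \<sigma>.\<close>
  have sumsq: "sim_on {1..} (\<lambda>n. ereal (sqrt (\<Sum>i=1..n. (l2norm \<Omega> (\<phi> n i))\<^sup>2))) (\<lambda>n. ereal 1)"
  proof -
    obtain C1 where C1: "C1 > 0" "\<And>n i. i \<in> {1..n} \<Longrightarrow> l2norm \<Omega> (\<phi> n i) \<le> C1 * h n powr (d / 2)"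
      using basis_L2 by (auto simp: sim_on_def lesssim_on_def)
    obtain C2 where C2: "C2 > 0" "\<And>n i. i \<in> {1..n} \<Longrightarrow> h n powr (d / 2) \<le> C2 * l2norm \<Omega> (\<phi> n i)"
      using basis_L2 by (auto simp: sim_on_def lesssim_on_def)
    obtain C3 where C3: "C3 > 0" "\<And>n. n \<ge> 1 \<Longrightarrow> h n powr (d / 2) \<le> C3 * real n powr (- (1 / 2))"
      using h_half by (auto simp: sim_on_def lesssim_on_def)
    obtain C4 where C4: "C4 > 0" "\<And>n. n \<ge> 1 \<Longrightarrow> real n powr (- (1 / 2)) \<le> C4 * h n powr (d / 2)"
      using h_half by (auto simp: sim_on_def lesssim_on_def)
    have half: "real n powr (1 / 2) * (c * real n powr (- (1 / 2))) = c" if "n \<ge> 1" for n c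
      using that by (simp add: powr_add[symmetric] mult.left_commute)
    have "sqrt (\<Sum>i=1..n. (l2norm \<Omega> (\<phi> n i))\<^sup>2) \<le> C1 * C3" if n: "n \<ge> 1" for n
    proof -
      have "0 \<le> l2norm \<Omega> (\<phi> n i) \<and> l2norm \<Omega> (\<phi> n i) \<le> (C1 * C3) * real n powr (- (1 / 2))"
        if "i \<in> {1..n}" for i
      proof -
        have "l2norm \<Omega> (\<phi> n i) \<le> C1 * (C3 * real n powr (- (1 / 2)))"
          using C1(2)[OF that] mult_left_mono[OF C3(2)[OF n], of C1] C1(1) by linarith
        then show ?thesis by (simp add: l2norm_def mult.assoc)
      qed
      from sqrt_sum_power2_bounds(1)[where n=n and a="\<lambda>i. l2norm \<Omega> (\<phi> n i)", OF this]
      show ?thesis by (simp only: half[OF n])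
    qed
    moreover have "1 \<le> (C2 * C4) * sqrt (\<Sum>i=1..n. (l2norm \<Omega> (\<phi> n i))\<^sup>2)" if n: "n \<ge> 1" for n
    proof -
      have "1 / (C2 * C4) * real n powr (- (1 / 2)) \<le> l2norm \<Omega> (\<phi> n i)" if "i \<in> {1..n}" for i
      proof -
        have "real n powr (- (1 / 2)) \<le> C4 * (C2 * l2norm \<Omega> (\<phi> n i))"
          using C4(2)[OF n] mult_left_mono[OF C2(2)[OF that], of C4] C4(1) by linarith
        then show ?thesis using C2(1) C4(1) by (simp add: field_simps)
      qed
      from sqrt_sum_power2_bounds(2)[where n=n and a="\<lambda>i. l2norm \<Omega> (\<phi> n i)", OF this] C2(1) C4(1)
      have "1 / (C2 * C4) \<le> sqrt (\<Sum>i=1..n. (l2norm \<Omega> (\<phi> n i))\<^sup>2)" by (simp only: half[OF n]) simp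
      then show ?thesis using C2(1) C4(1) by (simp add: field_simps)
    qed
    ultimately show ?thesis unfolding sim_on_def lesssim_on_ereal_iff
      using C1(1) C2(1) C3(1) C4(1) by (intro conjI exI[of _ "C1 * C3"] exI[of _ "C2 * C4"]) auto
  qed
  have v0_sim: "sim_on {1..} (\<lambda>n. ereal (v0 n)) (\<lambda>n. ereal (real n powr (- lam / d)))"
    unfolding v0_def using sim_on_mult[OF \<sigma>_sim sumsq] \<sigma>_nn by (simp add: sum_nonneg)

  define b0 where "b0 n f = l2norm \<Omega> (\<lambda>t. recon_op \<phi> n (eval_op x n f) t - f t)" for n f
  have b0_nn: "b0 n f \<ge> 0" for n f by (simp add: b0_def l2norm_def)
  have approx_eq: "approx_err \<Omega> x \<phi> s R n = (SUP f\<in>F. ereal (b0 n f))" for n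
    by (simp add: approx_err_def b0_def F_def)
  have e0_eq: "e_noreg n = (SUP f\<in>F. ereal (sqrt ((b0 n f)\<^sup>2 + (v0 n)\<^sup>2)))" if n: "n \<ge> 1" for n
    unfolding e_noreg_def err_noreg_def F_def[symmetric]
  proof (intro SUP_cong refl arg_cong[where f=ereal] arg_cong[where f=sqrt])
    fix f assume f: "f \<in> F"
    show "(\<integral>\<omega>. (l2norm \<Omega> (\<lambda>t. recon_op \<phi> n (noisy_data x \<xi> n (\<sigma> n) f \<omega>) t - f t))\<^sup>2 \<partial>M)
        = (b0 n f)\<^sup>2 + (v0 n)\<^sup>2"
      unfolding noisy_data_def b0_def v0_def
      by (rule expected_sq_error[OF prob F_bdd[OF f] \<phi>_bdd noise_indep[OF n]])
        (use noise_integrable noise_mean noise_var in \<open>auto simp: recon_op_def\<close>)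
  qed
  have v0_nn: "v0 n \<ge> 0" if "n \<ge> 1" for n
    using \<sigma>_nn[OF that] by (simp add: v0_def sum_nonneg)
  have noreg: "sim_on {1..} e_noreg (\<lambda>n. ereal (real n powr max (- s_a / d) (- lam / d)))"
    by (rule sim_on_powr_max[OF approx' v0_sim])
      (auto simp: approx_eq e0_eq intro!: SUP_sqrt_power2_add F_ne b0_nn v0_nn)

  \<comment> \<open>Stability of convolution with the rescaled kernel\<close>
  define \<kappa> where "\<kappa> = (\<integral>t. \<bar>K t\<bar> \<partial>lborel)"
  have \<kappa>: "\<kappa> \<ge> 0" by (simp add: \<kappa>_def)
  have K_cont: "continuous_on UNIV K"
    using K_smooth unfolding smooth_on_def by (metis Ck_on.simps(1))
  have ker: "bounded_kernel \<Omega> (scaled_kernel K \<beta>)" if "\<beta> > 0" for \<beta>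
    using K_cont K_supp that
    by unfold_locales (rule measurable_scaled_kernel bounded_range_scaled_kernel integrable_scaled_kernel; assumption)+
  note ker_L1 = L1_scaled_kernel[OF K_cont K_supp, folded \<kappa>_def]
  note ker_L2 = L2_scaled_kernel[OF K_cont K_supp, folded d_def]
  define cv where "cv \<beta> = conv_on \<Omega> (scaled_kernel K \<beta>)" for \<beta>
  have cv_bdd: "cv \<beta> g \<in> bdd_meas N" if "\<beta> > 0" "g \<in> bdd_meas N" for \<beta> g
    using bounded_kernel.conv_bdd_meas[OF ker] that by (simp add: cv_def)
  \<comment> \<open>The constant \<kappa> is the same for all \<beta>, as rescaling preserves the L1
    norm of the kernel.\<close>
  have cv_L2: "L2_seminorm N (cv \<beta> g) \<le> \<kappa> * L2_seminorm N g" if "\<beta> > 0" "g \<in> bdd_meas N" for \<beta> g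
    using bounded_kernel.conv_L2_le[OF ker] that ker_L1 by (simp add: cv_def)

  \<comment> \<open>The order of the regularisation parameter and of its power s_r\<close>
  define \<beta> where "\<beta> n = \<beta>_star (\<sigma> n) n" for n
  have \<beta>: "\<beta> n > 0" if "n \<ge> 1" for n using \<beta>_pos \<sigma>_pos that by (simp add: \<beta>_def)
  \<comment> \<open>With \<sigma> of order n^(-lam/d), the prescribed \<beta> is of order n^(-q),
    where q = (2 lam / d + 1) / D. Its power s_r, the order of the smoothing error, is then
    n^(-p).\<close>
  define q where "q = (2 * lam + d) / (d * D)"
  define p where "p = (2 * lam + d) / D * (real s_r / d)"
  have q: "q > 0" using lam_nonneg d D by (simp add: q_def add_nonneg_pos)
  have pq: "p = q * real s_r" by (simp add: p_def q_def)
  have \<beta>_q: "sim_on {1..} (\<lambda>n. ereal (\<beta> n)) (\<lambda>n. ereal (real n powr (- q)))"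
  proof -
    have 1: "sim_on {1..} (\<lambda>n. ereal (\<beta> n)) (\<lambda>n. ereal (\<sigma> n powr (2 / D) * real n powr (- 1 / D)))"
      using sim_on_compose[OF \<beta>_sim, of "{1..}" "\<lambda>n. (\<sigma> n, n)"] \<sigma>_pos by (simp add: \<beta>_def D_def)
    have 2: "sim_on {1..} (\<lambda>n. ereal (\<sigma> n powr (2 / D))) (\<lambda>n. ereal ((real n powr (- lam / d)) powr (2 / D)))"
      using \<sigma>_nn D by (intro sim_on_powr[OF \<sigma>_sim]) auto
    have 3: "sim_on {1..} (\<lambda>n. ereal (real n powr (- 1 / D))) (\<lambda>n. ereal (real n powr (- 1 / D)))"
      by (auto simp: sim_on_def intro: lesssim_on_mono)
    have "sim_on {1..} (\<lambda>n. ereal (\<beta> n)) (\<lambda>n. ereal ((real n powr (- lam / d)) powr (2 / D) * real n powr (- 1 / D)))"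
      by (rule sim_on_trans[OF 1 sim_on_mult[OF 2 3]]) auto
    moreover have "(real n powr (- lam / d)) powr (2 / D) * real n powr (- 1 / D) = real n powr (- q)" for n
    proof -
      have "- lam / d * (2 / D) + - 1 / D = - q" using d D by (simp add: q_def field_simps)
      then show ?thesis by (simp add: powr_powr powr_add[symmetric])
    qed
    ultimately show ?thesis by simp
  qed
  have \<beta>_sr: "sim_on {1..} (\<lambda>n. ereal (\<beta> n ^ s_r)) (\<lambda>n. ereal (real n powr (- p)))"
  proof -
    have "sim_on {1..} (\<lambda>n. ereal (\<beta> n powr real s_r)) (\<lambda>n. ereal ((real n powr (- q)) powr real s_r))"
      using \<beta> by (intro sim_on_powr[OF \<beta>_q]) (auto intro: less_imp_le)
    then show ?thesis
      by (rule sim_on_cong) (use \<beta> in \<open>auto simp: powr_realpow powr_powr pq\<close>)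
  qed

  \<comment> \<open>The noise part of the regularised error\<close>
  define v1 where "v1 n = \<sigma> n * sqrt (\<Sum>i=1..n. (l2norm \<Omega> (cv (\<beta> n) (\<phi> n i)))\<^sup>2)" for n
  have v1_nn: "v1 n \<ge> 0" if "n \<ge> 1" for n
    using \<sigma>_nn[OF that] by (simp add: v1_def sum_nonneg)
  \<comment> \<open>Young's inequality bounds each norm by a multiple of \<beta>^(-d/2) / n, and
    summing n squares costs a factor sqrt n. An upper bound is enough, because the lower bound on
    \<open>e_reg\<close> will come from the bias.\<close>
  have v1_le: "lesssim_on {1..} (\<lambda>n. ereal (v1 n)) (\<lambda>n. ereal (real n powr (- p)))"
  proof -
    obtain C1 where C1: "C1 > 0" "\<And>n i. i \<in> {1..n} \<Longrightarrow> l1norm \<Omega> (\<phi> n i) \<le> C1 * h n powr d"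
      using basis_L1 by (auto simp: sim_on_def lesssim_on_def)
    have "sim_on {1..} (\<lambda>n. ereal (h n powr d)) (\<lambda>n. ereal (real n powr (- 1)))"
      using h_powr[of d] d by simp
    then obtain C2 where C2: "C2 > 0" "\<And>n. n \<ge> 1 \<Longrightarrow> h n powr d \<le> C2 * real n powr (- 1)"
      by (auto simp: sim_on_def lesssim_on_def)
    define C where "C = L2_seminorm lborel K * (C1 * C2) + 1"
    have K2: "L2_seminorm lborel K \<ge> 0" by (simp add: L2_seminorm_def)
    have C: "C > 0" using C1(1) C2(1) K2 by (simp add: C_def add_nonneg_pos)
    have "sqrt (\<Sum>i=1..n. (l2norm \<Omega> (cv (\<beta> n) (\<phi> n i)))\<^sup>2) \<le> C * (\<beta> n powr (- (d / 2)) * real n powr (- (1 / 2)))"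
      if n: "n \<ge> 1" for n
    proof -
      have "0 \<le> l2norm \<Omega> (cv (\<beta> n) (\<phi> n i)) \<and>
          l2norm \<Omega> (cv (\<beta> n) (\<phi> n i)) \<le> C * (\<beta> n powr (- (d / 2)) * real n powr (- 1))"
        if i: "i \<in> {1..n}" for i
      proof
        have "l2norm \<Omega> (cv (\<beta> n) (\<phi> n i)) = L2_seminorm N (cv (\<beta> n) (\<phi> n i))"
          using \<beta>[OF n] \<phi>_bdd[OF i] by (intro l2norm_eq cv_bdd)
        also have "\<dots> \<le> L2_seminorm lborel (scaled_kernel K (\<beta> n)) * (\<integral>t. \<bar>\<phi> n i t\<bar> \<partial>N)"
          unfolding cv_def by (rule bounded_kernel.conv_L2_le_L1[OF ker[OF \<beta>[OF n]] \<phi>_bdd[OF i]])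
        also have "\<dots> = \<beta> n powr (- (d / 2)) * L2_seminorm lborel K * l1norm \<Omega> (\<phi> n i)"
          using ker_L2[OF \<beta>[OF n]] by (simp add: l1norm_eq[OF \<phi>_bdd[OF i]])
        also have "\<dots> \<le> \<beta> n powr (- (d / 2)) * L2_seminorm lborel K * (C1 * (C2 * real n powr (- 1)))"
          using C1 C2(2)[OF n] K2 i by (intro mult_left_mono order_trans[OF C1(2)]) auto
        also have "\<dots> = L2_seminorm lborel K * (C1 * C2) * (\<beta> n powr (- (d / 2)) * real n powr (- 1))"
          by (simp add: mult_ac)
        also have "\<dots> \<le> C * (\<beta> n powr (- (d / 2)) * real n powr (- 1))"
          by (intro mult_right_mono) (auto simp: C_def)
        finally show "l2norm \<Omega> (cv (\<beta> n) (\<phi> n i)) \<le> C * (\<beta> n powr (- (d / 2)) * real n powr (- 1))" .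
      qed (simp add: l2norm_def)
      from sqrt_sum_power2_bounds(1)[where n=n and a="\<lambda>i. l2norm \<Omega> (cv (\<beta> n) (\<phi> n i))", OF this]
      have "sqrt (\<Sum>i=1..n. (l2norm \<Omega> (cv (\<beta> n) (\<phi> n i)))\<^sup>2)
          \<le> C * (\<beta> n powr (- (d / 2)) * (real n powr (1 / 2) * real n powr (- 1)))"
        by (simp add: mult_ac)
      then show ?thesis by (simp only: powr_add[symmetric]) simp
    qed
    then have 1: "lesssim_on {1..} (\<lambda>n. ereal (sqrt (\<Sum>i=1..n. (l2norm \<Omega> (cv (\<beta> n) (\<phi> n i)))\<^sup>2)))
        (\<lambda>n. ereal (\<beta> n powr (- (d / 2)) * real n powr (- (1 / 2))))"
      using C unfolding lesssim_on_ereal_iff by auto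
    have "lesssim_on {1..} (\<lambda>n. ereal (\<beta> n powr (- (d / 2)))) (\<lambda>n. ereal ((real n powr (- q)) powr (- (d / 2))))"
      using \<beta>_q \<beta> d by (intro lesssim_on_powr_minus) (auto simp: sim_on_def)
    then have "lesssim_on {1..} (\<lambda>n. ereal (\<beta> n powr (- (d / 2)) * real n powr (- (1 / 2))))
        (\<lambda>n. ereal ((real n powr (- q)) powr (- (d / 2)) * real n powr (- (1 / 2))))"
      by (rule lesssim_on_mult) (auto intro: lesssim_on_mono)
    with 1 have 2: "lesssim_on {1..} (\<lambda>n. ereal (sqrt (\<Sum>i=1..n. (l2norm \<Omega> (cv (\<beta> n) (\<phi> n i)))\<^sup>2)))
        (\<lambda>n. ereal ((real n powr (- q)) powr (- (d / 2)) * real n powr (- (1 / 2))))"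
      by (rule lesssim_on_trans)
    have "lesssim_on {1..} (\<lambda>n. ereal (v1 n))
        (\<lambda>n. ereal (real n powr (- lam / d) * ((real n powr (- q)) powr (- (d / 2)) * real n powr (- (1 / 2)))))"
      unfolding v1_def using \<sigma>_sim by (intro lesssim_on_mult 2) (auto simp: sim_on_def sum_nonneg)
    moreover have "real n powr (- lam / d) * ((real n powr (- q)) powr (- (d / 2)) * real n powr (- (1 / 2)))
        = real n powr (- p)" for n
    proof -
      \<comment> \<open>The balance behind the choice of \<beta>: since s_r + d/2 = D/2, the sum p +
        q d / 2 equals q D / 2, which is lam / d + 1/2.\<close>
      have "- lam / d + (- q * (- (d / 2)) + - (1 / 2)) = - p"
      proof -
        have s_r_eq: "real s_r = (D - d) / 2" by (simp add: D_def)
        show ?thesis unfolding q_def p_def s_r_eq using d D by (simp add: field_simps)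
      qed
      then show ?thesis by (simp add: powr_powr powr_add[symmetric])
    qed
    ultimately show ?thesis by simp
  qed

  \<comment> \<open>The bias of the regularised reconstruction\<close>
  define b1 where "b1 n f = l2norm \<Omega> (\<lambda>t. cv (\<beta> n) (recon_op \<phi> n (eval_op x n f)) t - f t)" for n f
  have b1_nn: "b1 n f \<ge> 0" for n f by (simp add: b1_def l2norm_def)
  have cv_recon: "cv (\<beta> n) (recon_op \<phi> n z) t = (\<Sum>i=1..n. z i * cv (\<beta> n) (\<phi> n i) t)" if "n \<ge> 1" for n z t
    unfolding cv_def recon_op_def by (rule bounded_kernel.conv_on_sum[OF ker[OF \<beta>[OF that]] \<phi>_bdd])
  have recon_bdd: "recon_op \<phi> n z \<in> bdd_meas N" for n z
    unfolding recon_op_def by (intro bdd_meas_sum bdd_meas_cmult \<phi>_bdd)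
  have e1_eq: "e_reg n = (SUP f\<in>F. ereal (sqrt ((b1 n f)\<^sup>2 + (v1 n)\<^sup>2)))" if n: "n \<ge> 1" for n
    unfolding e_reg_def err_reg_def F_def[symmetric] \<beta>_def[symmetric] cv_def[symmetric]
  proof (intro SUP_cong refl arg_cong[where f=ereal] arg_cong[where f=sqrt])
    fix f assume f: "f \<in> F"
    show "(\<integral>\<omega>. (l2norm \<Omega> (\<lambda>t. cv (\<beta> n) (recon_op \<phi> n (noisy_data x \<xi> n (\<sigma> n) f \<omega>)) t - f t))\<^sup>2 \<partial>M)
        = (b1 n f)\<^sup>2 + (v1 n)\<^sup>2"
      unfolding noisy_data_def b1_def v1_def
      by (rule expected_sq_error[OF prob F_bdd[OF f] cv_bdd[OF \<beta>[OF n] \<phi>_bdd] noise_indep[OF n]])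
        (use noise_integrable noise_mean noise_var in \<open>auto simp: cv_recon[OF n]\<close>)
  qed
  define sm where "sm \<beta> f = l2norm \<Omega> (\<lambda>t. cv \<beta> f t - f t)" for \<beta> f
  have sm_eq: "smoothing_err \<Omega> K s R \<beta> = (SUP f\<in>F. ereal (sm \<beta> f))" for \<beta>
    by (simp add: smoothing_err_def F_def sm_def cv_def)
  \<comment> \<open>With P the noiseless reconstruction of f, the regularised error K*P - f is the
    sum of K*(P - f) and K*f - f. The first part costs at most \<kappa> times the approximation
    error, and the triangle inequality is used in both directions.\<close>
  have bias: "b1 n f \<le> \<kappa> * b0 n f + sm (\<beta> n) f" "sm (\<beta> n) f \<le> b1 n f + \<kappa> * b0 n f"
    if n: "n \<ge> 1" and f: "f \<in> F" for n f
  proof -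
    let ?P = "recon_op \<phi> n (eval_op x n f)" and ?L = "L2_seminorm N" and ?c = "cv (\<beta> n)"
    note bdd = F_bdd[OF f] recon_bdd[of n "eval_op x n f"]
    note cb = cv_bdd[OF \<beta>[OF n] bdd(1)] cv_bdd[OF \<beta>[OF n] bdd(2)]
    have eqs: "b1 n f = ?L (\<lambda>t. ?c ?P t - f t)" "b0 n f = ?L (\<lambda>t. ?P t - f t)" "sm (\<beta> n) f = ?L (\<lambda>t. ?c f t - f t)"
      unfolding b1_def b0_def sm_def by (intro l2norm_eq bdd_meas_diff bdd cb)+
    have "?c (\<lambda>t. ?P t - f t) = (\<lambda>t. ?c ?P t - ?c f t)"
      unfolding cv_def by (intro ext bounded_kernel.conv_on_diff[OF ker[OF \<beta>[OF n]] bdd(2,1)])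
    then have d: "?L (\<lambda>t. ?c ?P t - ?c f t) \<le> \<kappa> * b0 n f"
      using cv_L2[OF \<beta>[OF n] bdd_meas_diff[OF bdd(2,1)]] by (simp add: eqs)
    have d': "?L (\<lambda>t. ?c f t - ?c ?P t) = ?L (\<lambda>t. ?c ?P t - ?c f t)"
      by (simp add: L2_seminorm_def power2_commute)
    show "b1 n f \<le> \<kappa> * b0 n f + sm (\<beta> n) f"
      using L2_seminorm_diff_triangle[OF cb(2,1) bdd(1)] d by (simp add: eqs)
    show "sm (\<beta> n) f \<le> b1 n f + \<kappa> * b0 n f"
      using L2_seminorm_diff_triangle[OF cb(1,2) bdd(1)] d d' by (simp add: eqs)
  qed
  have SUP_b1_le: "(SUP f\<in>F. ereal (b1 n f)) \<le> ereal \<kappa> * approx_err \<Omega> x \<phi> s R n + smoothing_err \<Omega> K s R (\<beta> n)"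
    if n: "n \<ge> 1" for n
    unfolding approx_eq sm_eq
  proof (rule SUP_least)
    fix f assume f: "f \<in> F"
    have "ereal (b1 n f) \<le> ereal \<kappa> * ereal (b0 n f) + ereal (sm (\<beta> n) f)" using bias(1)[OF n f] by simp
    also have "\<dots> \<le> ereal \<kappa> * (SUP f\<in>F. ereal (b0 n f)) + (SUP f\<in>F. ereal (sm (\<beta> n) f))"
      using f \<kappa> by (intro add_mono ereal_mult_left_mono SUP_upper) auto
    finally show "ereal (b1 n f) \<le> \<dots>" .
  qed
  \<comment> \<open>The approximation error stays on the right as an added term, which avoids
    subtracting suprema that are extended reals.\<close>
  have sm_le: "smoothing_err \<Omega> K s R (\<beta> n) \<le> e_reg n + ereal \<kappa> * approx_err \<Omega> x \<phi> s R n"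
    if n: "n \<ge> 1" for n
    unfolding approx_eq sm_eq
  proof (rule SUP_least)
    fix f assume f: "f \<in> F"
    have "ereal (sm (\<beta> n) f) \<le> ereal (b1 n f) + ereal \<kappa> * ereal (b0 n f)" using bias(2)[OF n f] by simp
    also have "\<dots> \<le> (SUP f\<in>F. ereal (b1 n f)) + ereal \<kappa> * (SUP f\<in>F. ereal (b0 n f))"
      using f \<kappa> by (intro add_mono ereal_mult_left_mono SUP_upper) auto
    also have "(SUP f\<in>F. ereal (b1 n f)) \<le> e_reg n"
      unfolding e1_eq[OF n] by (intro SUP_sqrt_power2_add F_ne b1_nn v1_nn n)
    finally show "ereal (sm (\<beta> n) f) \<le> e_reg n + ereal \<kappa> * (SUP f\<in>F. ereal (b0 n f))"
      by (simp add: add_right_mono)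
  qed

  \<comment> \<open>Upper bound on the regularised error\<close>
  have reg_upper: "lesssim_on {1..} e_reg (\<lambda>n. ereal (real n powr max (- p) (- s_a / d)))"
  proof -
    let ?w = "\<lambda>n. ereal (real n powr max (- p) (- s_a / d))"
    have to_w: "lesssim_on {1..} u ?w"
      if "lesssim_on {1..} u (\<lambda>n. ereal (real n powr r))" "r \<le> max (- p) (- s_a / d)" for u r
      using lesssim_on_trans[OF that(1) lesssim_on_powr_nat[OF that(2)]] .
    have 1: "lesssim_on {1..} (\<lambda>n. ereal \<kappa> * approx_err \<Omega> x \<phi> s R n) ?w"
      using approx' \<kappa> by (intro lesssim_on_cmult to_w[of _ "- s_a / d"]) (auto simp: sim_on_def)
    have "lesssim_on {1..} (\<lambda>n. smoothing_err \<Omega> K s R (\<beta> n)) (\<lambda>n. ereal (\<beta> n ^ s_r))"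
      using \<beta> by (intro lesssim_on_compose[OF smoothing_upper[OF s_sr s_gt R_pos]]) auto
    then have "lesssim_on {1..} (\<lambda>n. smoothing_err \<Omega> K s R (\<beta> n)) (\<lambda>n. ereal (real n powr (- p)))"
      using \<beta>_sr lesssim_on_trans unfolding sim_on_def by blast
    then have 2: "lesssim_on {1..} (\<lambda>n. smoothing_err \<Omega> K s R (\<beta> n)) ?w" by (rule to_w) simp
    have 3: "lesssim_on {1..} (\<lambda>n. ereal (v1 n)) ?w" using v1_le by (rule to_w) simp
    have "e_reg n \<le> ereal \<kappa> * approx_err \<Omega> x \<phi> s R n + smoothing_err \<Omega> K s R (\<beta> n) + ereal (v1 n)"
      if n: "n \<ge> 1" for n
    proof -
      have "e_reg n \<le> (SUP f\<in>F. ereal (b1 n f)) + ereal (v1 n)"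
        unfolding e1_eq[OF n] by (intro SUP_sqrt_power2_add F_ne b1_nn v1_nn n)
      also have "\<dots> \<le> ereal \<kappa> * approx_err \<Omega> x \<phi> s R n + smoothing_err \<Omega> K s R (\<beta> n) + ereal (v1 n)"
        by (intro add_right_mono SUP_b1_le n)
      finally show ?thesis .
    qed
    then have "lesssim_on {1..} e_reg
        (\<lambda>n. ereal \<kappa> * approx_err \<Omega> x \<phi> s R n + smoothing_err \<Omega> K s R (\<beta> n) + ereal (v1 n))"
      by (intro lesssim_on_mono) simp
    then show ?thesis by (rule lesssim_on_trans[OF _ lesssim_on_add[OF lesssim_on_add[OF 1 2] 3]])
  qed

  \<comment> \<open>Positivity and lower bound of the regularised error\<close>
  obtain \<beta>0 C0 where \<beta>0: "\<beta>0 > 0" "C0 > 0"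
    "\<And>\<beta>. 0 < \<beta> \<Longrightarrow> \<beta> \<le> \<beta>0 \<Longrightarrow> ereal (\<beta> ^ s_r) \<le> ereal C0 * smoothing_err \<Omega> K s R \<beta>"
    using smoothing_lower[OF s_sr s_gt R_pos] by (auto simp: lesssim_on_def)
  text \<open>If \<open>e_reg n\<close> vanished, every \<open>K\<^sub>\<beta> * \<phi>\<^sub>i\<close> would be zero, so the bias of \<open>f\<close> would be \<open>\<parallel>f\<parallel>\<close>; then
    all of \<open>F\<close> would vanish, contradicting the lower bound on the smoothing error.\<close>
  have reg_pos: "e_reg n > 0" if n: "n \<ge> 1" for n
  proof (rule ccontr)
    assume "\<not> e_reg n > 0"
    then have e: "e_reg n \<le> 0" by simp
    have "ereal (v1 n) \<le> e_reg n"
      unfolding e1_eq[OF n] by (intro SUP_sqrt_power2_add F_ne b1_nn v1_nn n)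
    then have "ereal (v1 n) \<le> 0" using e by (rule order_trans)
    then have "v1 n = 0" using v1_nn[OF n] by simp
    then have z: "l2norm \<Omega> (cv (\<beta> n) (\<phi> n i)) = 0" if "i \<in> {1..n}" for i
      using \<sigma>_pos[OF n] that by (simp add: v1_def sum_nonneg_eq_0_iff)
    have f0: "L2_seminorm N f = 0" if f: "f \<in> F" for f
    proof -
      let ?y = "eval_op x n f"
      have cb: "cv (\<beta> n) (recon_op \<phi> n ?y) \<in> bdd_meas N"
        by (rule cv_bdd[OF \<beta>[OF n] recon_bdd])
      have "L2_seminorm N (\<lambda>t. \<Sum>i=1..n. ?y i * cv (\<beta> n) (\<phi> n i) t) = 0"
        using z by (intro L2_seminorm_sum_zero) (auto simp: l2norm_eq cv_bdd \<beta>[OF n] \<phi>_bdd)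
      then have 1: "L2_seminorm N (cv (\<beta> n) (recon_op \<phi> n ?y)) = 0"
        by (simp add: cv_recon[OF n, abs_def] cv_recon[OF n] L2_seminorm_def)
      have "ereal (b1 n f) \<le> (SUP f\<in>F. ereal (b1 n f))" using f by (rule SUP_upper)
      also have "\<dots> \<le> e_reg n"
        unfolding e1_eq[OF n] by (intro SUP_sqrt_power2_add F_ne b1_nn v1_nn n)
      also note e
      finally have "b1 n f = 0" using b1_nn[of n f] by simp
      then have 2: "L2_seminorm N (\<lambda>t. f t - cv (\<beta> n) (recon_op \<phi> n ?y) t) = 0"
        using l2norm_eq[OF bdd_meas_diff[OF cb F_bdd[OF f]]]
        by (simp add: b1_def L2_seminorm_def power2_commute)
      have "L2_seminorm N f \<le> 0"
        using L2_seminorm_diff_triangle[OF F_bdd[OF f] cb bdd_meas_const[of 0]] 1 2 by simp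
      then show ?thesis by (simp add: L2_seminorm_def antisym)
    qed
    have "smoothing_err \<Omega> K s R \<beta>0 \<le> 0"
      unfolding sm_eq
    proof (rule SUP_least)
      fix f assume f: "f \<in> F"
      have cb: "cv \<beta>0 f \<in> bdd_meas N" by (rule cv_bdd[OF \<beta>0(1) F_bdd[OF f]])
      have "sm \<beta>0 f = L2_seminorm N (\<lambda>t. cv \<beta>0 f t - f t)"
        unfolding sm_def by (intro l2norm_eq bdd_meas_diff cb F_bdd[OF f])
      also have "\<dots> \<le> L2_seminorm N (cv \<beta>0 f) + L2_seminorm N f"
        using L2_seminorm_diff_triangle[OF cb bdd_meas_const[of 0] F_bdd[OF f]] by (simp add: L2_seminorm_def)
      also have "\<dots> \<le> 0" using cv_L2[OF \<beta>0(1) F_bdd[OF f]] f0[OF f] by simp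
      finally show "ereal (sm \<beta>0 f) \<le> 0" by simp
    qed
    then have "ereal C0 * smoothing_err \<Omega> K s R \<beta>0 \<le> ereal C0 * 0"
      using \<beta>0(2) by (intro ereal_mult_left_mono) auto
    with \<beta>0(3)[OF \<beta>0(1) order_refl] have "ereal (\<beta>0 ^ s_r) \<le> ereal C0 * 0" by (rule order_trans)
    then show False using zero_less_power[OF \<beta>0(1), of s_r] by simp
  qed

  \<comment> \<open>Under this condition on p the approximation error is of smaller order than the
    smoothing error. For large n it takes away at most half of the lower bound, and positivity of
    \<open>e_reg\<close> handles the remaining indices.\<close>
  have reg_lower: "lesssim_on {1..} (\<lambda>n. ereal (real n powr (- p))) e_reg" if p_lt: "p < s_a / d"
  proof -
    obtain C1 where C1: "C1 > 0" "\<And>n. n \<ge> 1 \<Longrightarrow> \<beta> n \<le> C1 * real n powr (- q)"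
      using \<beta>_q by (auto simp: sim_on_def lesssim_on_def)
    obtain C2 where C2: "C2 > 0" "\<And>n. n \<ge> 1 \<Longrightarrow> real n powr (- p) \<le> C2 * \<beta> n ^ s_r"
      using \<beta>_sr by (auto simp: sim_on_def lesssim_on_def)
    obtain C3 where C3: "C3 > 0"
      "\<And>n. n \<ge> 1 \<Longrightarrow> approx_err \<Omega> x \<phi> s R n \<le> ereal (C3 * real n powr (- s_a / d))"
      using approx' by (auto simp: sim_on_def lesssim_on_def)
    define C4 where "C4 = C2 * C0 * \<kappa> * C3 + 1"
    have C4: "C4 > 0" using C2(1) C3(1) \<beta>0(2) \<kappa> by (simp add: C4_def add_nonneg_pos)
    \<comment> \<open>The first threshold brings \<beta> n below \<beta>0, where the smoothing lower
      bound is available; the second makes C4 n^(-s_a/d) at most half of n^(-p).\<close>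
    have "eventually (\<lambda>n. real n powr (- q) \<le> \<beta>0 / C1 \<and> real n powr (- (s_a / d - p)) \<le> 1 / (2 * C4)) sequentially"
      using q \<beta>0(1) C1(1) C4 p_lt by (intro eventually_conj eventually_powr_minus_le) auto
    then obtain m where m: "\<And>n. n \<ge> m \<Longrightarrow> real n powr (- q) \<le> \<beta>0 / C1"
      "\<And>n. n \<ge> m \<Longrightarrow> real n powr (- (s_a / d - p)) \<le> 1 / (2 * C4)"
      unfolding eventually_sequentially by blast
    show ?thesis
    \<comment> \<open>C2 and C0 arise in passing from n^(-p) to the power of \<beta> n and then to
      the smoothing error; the 2 accounts for the half absorbed by the approximation error.\<close>
    proof (rule lesssim_on_eventually[where m = "max m 1" and c = "1 / (2 * C2 * C0)"])
      fix n assume "max m 1 \<le> n"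
      then have n: "n \<ge> 1" "n \<ge> m" by auto
      have "\<beta> n \<le> \<beta>0"
        using C1(2)[OF n(1)] m(1)[OF n(2)] C1(1) by (simp add: field_simps)
      from \<beta>0(3)[OF \<beta>[OF n(1)] this]
      have sm: "ereal (\<beta> n ^ s_r) \<le> ereal C0 * smoothing_err \<Omega> K s R (\<beta> n)" .
      have "ereal \<kappa> * approx_err \<Omega> x \<phi> s R n \<le> ereal \<kappa> * ereal (C3 * real n powr (- s_a / d))"
        using C3(2)[OF n(1)] \<kappa> by (intro ereal_mult_left_mono) auto
      then have "smoothing_err \<Omega> K s R (\<beta> n) \<le> e_reg n + ereal (\<kappa> * (C3 * real n powr (- s_a / d)))"
        using sm_le[OF n(1)] by (auto intro: order_trans add_left_mono)
      then have "ereal C0 * smoothing_err \<Omega> K s R (\<beta> n)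
          \<le> ereal C0 * (e_reg n + ereal (\<kappa> * (C3 * real n powr (- s_a / d))))"
        using \<beta>0(2) by (intro ereal_mult_left_mono) auto
      with sm have lower: "ereal (\<beta> n ^ s_r) \<le> ereal C0 * (e_reg n + ereal (\<kappa> * (C3 * real n powr (- s_a / d))))"
        by (rule order_trans)
      \<comment> \<open>The value infinity is trivial and minus infinity is excluded by
        \<open>reg_pos\<close>, so only a finite \<open>e_reg n\<close> needs the
        computation.\<close>
      show "ereal (1 / (2 * C2 * C0) * real n powr (- p)) \<le> e_reg n"
      proof (cases "e_reg n")
        case (real r)
        have "\<beta> n ^ s_r \<le> C0 * (r + \<kappa> * (C3 * real n powr (- s_a / d)))" using lower real by simp
        then have "C2 * \<beta> n ^ s_r \<le> C2 * (C0 * (r + \<kappa> * (C3 * real n powr (- s_a / d))))"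
          using C2(1) by (intro mult_left_mono) auto
        then have "real n powr (- p) \<le> C2 * C0 * r + (C4 - 1) * real n powr (- s_a / d)"
          using C2(2)[OF n(1)] by (simp add: C4_def algebra_simps)
        also have "\<dots> \<le> C2 * C0 * r + C4 * real n powr (- s_a / d)" by (simp add: mult_right_mono)
        also have "C4 * real n powr (- s_a / d) = C4 * real n powr (- (s_a / d - p)) * real n powr (- p)"
          by (simp add: powr_add[symmetric] mult.assoc)
        also have "\<dots> \<le> 1 / 2 * real n powr (- p)"
          using m(2)[OF n(2)] C4 by (intro mult_right_mono) (auto simp: field_simps)
        finally show ?thesis using real C2(1) \<beta>0(2) by (simp add: field_simps)
      qed (use reg_pos[OF n(1)] in auto)
    qed (use C2(1) \<beta>0(2) reg_pos in auto)
  qed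

  \<comment> \<open>Comparison of the exponents and the three noise regimes\<close>
  have crossover: "p < s_a / d \<longleftrightarrow> lam < lam_M"
  proof -
    \<comment> \<open>\<open>lam_M\<close> is the value of lam at which (2 lam + d) s_r = s_a D,
      that is, at which p equals s_a / d. Clearing the denominator s_r makes this a linear
      identity.\<close>
    have lam_M_s_r: "lam_M * real s_r = s_a * real s_r + d / 2 * (s_a - real s_r)"
      using sr by (simp add: lam_M_def distrib_right left_diff_distrib mult.assoc)
    have "p = (2 * lam + d) * real s_r / D / d" by (simp add: p_def)
    then have "p < s_a / d \<longleftrightarrow> (2 * lam + d) * real s_r < s_a * D"
      using d D by (simp add: divide_less_cancel pos_divide_less_eq)
    also have "\<dots> \<longleftrightarrow> 2 * lam * real s_r < 2 * (lam_M * real s_r)"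
    proof -
      have "2 * (lam_M * real s_r) = s_a * D - d * real s_r"
        unfolding lam_M_s_r by (simp add: D_def field_simps)
      then show ?thesis by (simp add: distrib_right less_diff_eq)
    qed
    also have "\<dots> \<longleftrightarrow> lam < lam_M" using sr by simp
    finally show ?thesis .
  qed
  \<comment> \<open>Hence the regime \<open>lam \<le> s_a\<close> lies below \<open>lam_M\<close>
    and shares the sharp regularised rate, while \<open>lam_M \<le> lam\<close> implies
    \<open>s_a \<le> lam\<close> and fixes the unregularised rate.\<close>
  have lam_M_gt: "s_a < lam_M" using d sr s_a_gt by (simp add: lam_M_def)
  have p_eq: "- ((2 * lam + d) / (2 * real s_r + d) * (real s_r / d)) = - p"
    by (simp add: p_def D_def)
  have reg_sim: "sim_on {1..} e_reg (\<lambda>n. ereal (real n powr (- p)))" if "lam < lam_M"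
  proof -
    have p: "p < s_a / d" using that crossover by simp
    then have "max (- p) (- s_a / d) = - p" by simp
    then show ?thesis using reg_upper reg_lower[OF p] by (simp add: sim_on_def)
  qed
  have reg_le: "lesssim_on {1..} e_reg (\<lambda>n. ereal (real n powr (- s_a / d)))" if "lam_M \<le> lam"
  proof -
    have "max (- p) (- s_a / d) = - s_a / d" using that crossover by simp
    then show ?thesis using reg_upper by simp
  qed
  have noreg_le: "sim_on {1..} e_noreg (\<lambda>n. ereal (real n powr (- lam / d)))" if "lam \<le> s_a"
  proof -
    have "max (- s_a / d) (- lam / d) = - lam / d" using that d by (simp add: divide_right_mono)
    then show ?thesis using noreg by simp
  qed
  have noreg_ge: "sim_on {1..} e_noreg (\<lambda>n. ereal (real n powr (- s_a / d)))" if "s_a \<le> lam"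
  proof -
    have "max (- s_a / d) (- lam / d) = - s_a / d" using that d by (simp add: divide_right_mono)
    then show ?thesis using noreg by simp
  qed
  show ?thesis
    unfolding p_eq using reg_sim reg_le noreg_le noreg_ge lam_M_gt by auto
qed

end
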